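(* Let $v:(0,\infty)^d\to(0,\infty)$ be a bounded positive measurable function such that $\int_{(0,\infty)^d}v(y)p(y)\,dy=1$, and for $(a,x)\in(0,\infty)^d\times\mathbb{R}^n$ let $$\phi_v(a,x)=\int_{(0,\infty)^d}p(z)\,v\big(a_1+e^{-2\alpha_1(x)}z_1,\ldots,a_d+e^{-2\alpha_d(x)}z_d\big)\,dz,\qquad F_v(a,x)=(\nabla_x\ln\phi_v)(a,x).$$ Then $F_v(a,x)$ depends only on $x$ (i.e. is independent of $a$) if and only if there is $\theta\in\mathbb{R}^d$ such that $$v(y)=\frac{e^{-\sum_{i=1}^d\theta_i^2y_i}}{j_\mu^\theta(0)}\qquad\text{for Lebesgue-almost every }y\in(0,\infty)^d .$$
   Context: Let $\alpha_1,\ldots,\alpha_d$ be distinct non-zero vectors in $\mathbb{R}^n$; write $\alpha_i(x)=(\alpha_i,x)$ with $(\cdot,\cdot)$ the usual inner product. Assume $\Omega=\{x\in\mathbb{R}^n:\alpha_i(x)>0\ \forall i\}$ is non-empty and let $\mu\in\Omega$. Let $B^{(\mu)}$ be a standard Brownian motion in $\mathbb{R}^n$ with drift $\mu$, started at $0$, and $A_\infty^i=\int_0^\infty e^{-2\alpha_i(B_s^{(\mu)})}ds$, $i=1,\dots,d$ (almost surely finite). $A_\infty=(A_\infty^1,\dots,A_\infty^d)$ has a smooth density $p$ with respect to Lebesgue measure, supported on the closed positive orthant. For $\theta\in\mathbb{R}^d$, $j_\mu^\theta(x)=\mathbb{E}\big(e^{-\sum_{i=1}^d\theta_i^2e^{-2\alpha_i(x)}A_\infty^i}\big)$.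 (The function $F_v$ is the extra drift term of the Brownian motion with drift $\mu$ conditioned so that $A_\infty$ has law $v(y)p(y)\,dy$.) *)

theory Defs
  imports "HOL-Probability.Probability"
begin

definition standard_brownian_motion ::
    "'w measure \<Rightarrow> (real \<Rightarrow> 'w \<Rightarrow> real ^ 'n) \<Rightarrow> bool" where
  "standard_brownian_motion M W \<longleftrightarrow>
     prob_space M \<and>
     (\<forall>t\<ge>0. W t \<in> borel_measurable M) \<and>
     (\<forall>\<omega>\<in>space M. W 0 \<omega> = 0) \<and>
     (\<forall>\<omega>\<in>space M. continuous_on {0..} (\<lambda>t. W t \<omega>)) \<and>
     (\<forall>(t :: nat \<Rightarrow> real) m. 0 \<le> t 0 \<and> mono t \<longrightarrow>
        prob_space.indep_vars M (\<lambda>_. borel) (\<lambda>k \<omega>. W (t (Suc k)) \<omega> - W (t k) \<omega>) {..<m}) \<and>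
     (\<forall>s t. 0 \<le> s \<and> s < t \<longrightarrow>
        distributed M lborel (\<lambda>\<omega>. W t \<omega> - W s \<omega>)
          (\<lambda>x. ennreal (\<Prod>j\<in>UNIV. normal_density 0 (sqrt (t - s)) (x $ j))))"

definition brownian_motion_with_drift ::
    "'w measure \<Rightarrow> real ^ 'n \<Rightarrow> (real \<Rightarrow> 'w \<Rightarrow> real ^ 'n) \<Rightarrow> bool" where
  "brownian_motion_with_drift M \<mu> B \<longleftrightarrow>
     (\<exists>W. standard_brownian_motion M W \<and> (\<forall>t\<ge>0. \<forall>\<omega>\<in>space M. B t \<omega> = W t \<omega> + t *\<^sub>R \<mu>))"

definition Omega :: "('d \<Rightarrow> real ^ 'n) \<Rightarrow> (real ^ 'n) set" where
  "Omega \<alpha> = {x. \<forall>i. 0 < \<alpha> i \<bullet> x}"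

definition orthant :: "(real ^ 'd) set" where
  "orthant = {y. \<forall>i. 0 < y $ i}"

text \<open>The Bochner integral takes the value 0 at a path where the integral diverges; when
  the drift lies in \<^term>\<open>Omega \<alpha>\<close> this happens with probability zero.\<close>

definition A_infty ::
    "('d \<Rightarrow> real ^ 'n) \<Rightarrow> (real \<Rightarrow> 'w \<Rightarrow> real ^ 'n) \<Rightarrow> 'w \<Rightarrow> real ^ 'd" where
  "A_infty \<alpha> B \<omega> = (\<chi> i. LINT s:{0..}|lborel. exp (-2 * (\<alpha> i \<bullet> B s \<omega>)))"

definition j_fun ::
    "'w measure \<Rightarrow> ('d::finite \<Rightarrow> real ^ 'n) \<Rightarrow> (real \<Rightarrow> 'w \<Rightarrow> real ^ 'n) \<Rightarrow> real ^ 'd \<Rightarrow> real ^ 'n \<Rightarrow> real" where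
  "j_fun M \<alpha> B \<theta> x =
     (LINT \<omega>|M. exp (- (\<Sum>i\<in>UNIV. (\<theta> $ i)\<^sup>2 * exp (-2 * (\<alpha> i \<bullet> x)) * A_infty \<alpha> B \<omega> $ i)))"

definition phi ::
    "('d::finite \<Rightarrow> real ^ 'n) \<Rightarrow> (real ^ 'd \<Rightarrow> real) \<Rightarrow> (real ^ 'd \<Rightarrow> real) \<Rightarrow> real ^ 'd \<Rightarrow> real ^ 'n \<Rightarrow> real" where
  "phi \<alpha> p v a x =
     (LINT z:orthant|lborel. p z * v (\<chi> i. a $ i + exp (-2 * (\<alpha> i \<bullet> x)) * z $ i))"

text \<open>\<open>F\<close> is the gradient in \<open>x\<close> of \<open>ln \<phi>\<^sub>v\<close>. As a relation, this includes that the gradient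
  exists at every point and determines \<open>F a x\<close> for every \<open>a\<close> in the open orthant.\<close>

definition is_F ::
    "('d::finite \<Rightarrow> real ^ 'n) \<Rightarrow> (real ^ 'd \<Rightarrow> real) \<Rightarrow> (real ^ 'd \<Rightarrow> real) \<Rightarrow>
     (real ^ 'd \<Rightarrow> real ^ 'n \<Rightarrow> real ^ 'n) \<Rightarrow> bool" where
  "is_F \<alpha> p v F \<longleftrightarrow>
     (\<forall>a\<in>orthant. \<forall>x. GDERIV (\<lambda>x'. ln (phi \<alpha> p v a x')) x :> F a x)"

end

theory Submission
  imports Defs
begin

text \<open>
  Write \<open>A\<close> for \<^const>\<open>A_infty\<close> and \<open>c(x)\<close> for the vector with entries \<open>e\<^sup>-\<^sup>2\<^sup>\<alpha>\<^sup>i\<^sup>(\<^sup>x\<^sup>)\<close>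
  (\<open>exp_weights\<close> below), so that \<open>\<phi>\<^sub>v(a,x) = E v(a + c(x) A)\<close> with the componentwise product of vectors.

  If \<open>v\<close> is a normalised exponential, it turns the sum \<open>a + c(x) A\<close> into a product: \<open>\<phi>\<^sub>v(a,x)\<close> is
  \<open>e\<^sup>-\<^sup>l\<^sup>\<cdot>\<^sup>a\<close> times a function of \<open>x\<close>, and \<open>ln \<phi>\<^sub>v\<close> splits into a function of \<open>a\<close> and one of \<open>x\<close>. What is left
  is the differentiability of the Laplace transform \<open>x \<mapsto> E e\<^sup>-\<^sup>l\<^sup>\<cdot>\<^sup>c\<^sup>(\<^sup>x\<^sup>)\<^sup>A\<close> (\<open>laplace_A_GDERIV\<close>).

  Conversely, if the gradient of \<open>ln \<phi>\<^sub>v(a,\<cdot>)\<close> is the same for all \<open>a\<close>, then \<open>\<phi>\<^sub>v(a,x) = g(a) h(x)\<close>. For smooth data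
  one would now use the equation \<open>\<Delta>\<phi>/2 + \<mu>\<cdot>\<nabla>\<phi> + \<Sum>\<^sub>i c\<^sub>i(x) \<partial>\<phi>/\<partial>a\<^sub>i = 0\<close>: it shows that \<open>\<Sum>\<^sub>i c\<^sub>i(x) \<partial>\<^sub>i ln g(a)\<close> does not
  depend on \<open>a\<close>, and since the functions \<open>c\<^sub>i\<close> are linearly independent, each \<open>\<partial>\<^sub>i ln g\<close> is constant. As \<open>v\<close> is
  merely bounded and measurable, the same argument is carried out in integrated form.

  \<^item> The weight \<open>v\<close> is averaged over translates by an exponentially distributed vector (\<open>exp_average\<close>). The average
    is bounded and Lipschitz, it inherits the factorisation, and it determines \<open>v\<close> almost everywhere
    (\<open>exp_average_determines\<close>), because up to an explicit factor it is the mass that \<open>v(y) e\<^sup>-\<^sup>y dy\<close> gives to the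
    upper orthants, which form a generating \<open>\<pi>\<close>-system.

  \<^item> The Markov property at time \<open>t\<close>, \<open>A = A\<^sub>t + c(B\<^sub>t) A'\<close> with \<open>A'\<close> a copy of \<open>A\<close> independent of the path up to
    \<open>t\<close> (\<open>markov_A_infty\<close>), takes the place of the differential equation. For the factorised average it reads
    \<open>G(a) h(x) = E G(a + c(x) A\<^sub>t) h(x + B\<^sub>t)\<close>.

  \<^item> Since \<open>E \<bar>A\<^sub>t - t\<bar> = o(t)\<close> (\<open>A_upto_near\<close>) and \<open>G\<close> is Lipschitz, \<open>A\<^sub>t\<close> may be replaced by \<open>t\<close> up to \<open>o(t)\<close>.
    In the ratio of the identities at two points \<open>a\<close> and \<open>a'\<close> the factor \<open>E h(x + B\<^sub>t)\<close> cancels, and adding up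
    many short steps shows that \<open>G(a + r c(x)) / G(a)\<close> does not depend on \<open>a\<close> (\<open>ray_shift_of_markov\<close>).

  \<^item> As the \<open>\<alpha>\<^sub>i\<close> are distinct, the vectors \<open>c(x)\<close> span the whole space (\<open>span_exp_weights\<close>). So \<open>ln G\<close> changes
    by a quantity depending only on the shift, for every shift, and boundedness of \<open>G\<close> makes it an affine function
    with slopes of one sign (\<open>exponential_of_ray_shifts\<close>).

  \<^item> Letting \<open>x\<close> tend to infinity in the direction of \<open>\<mu>\<close> kills \<open>c(x)\<close>, so the averaged weight is proportional to \<open>G\<close>.
    Hence it is an exponential, and so is \<open>v\<close>; the normalisation of \<open>v\<close> fixes the constant.
\<close>

section \<open>Exponential weights and the open orthant\<close>

definition exp_weights :: "('d::finite \<Rightarrow> real ^ 'n) \<Rightarrow> real ^ 'n \<Rightarrow> real ^ 'd" where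
  "exp_weights \<alpha> x = (\<chi> i. exp (-2 * (\<alpha> i \<bullet> x)))"

lemma exp_weights_nth [simp]: "exp_weights \<alpha> x $ i = exp (-2 * (\<alpha> i \<bullet> x))"
  by (simp add: exp_weights_def)

lemma exp_weights_zero [simp]: "exp_weights \<alpha> 0 = 1"
  by (simp add: vec_eq_iff)

lemma exp_weights_add: "exp_weights \<alpha> (x + y) = exp_weights \<alpha> x * exp_weights \<alpha> y"
  by (simp add: vec_eq_iff inner_add_right exp_add[symmetric] algebra_simps)

lemma exp_weights_orthant: "exp_weights \<alpha> x \<in> orthant"
  by (simp add: orthant_def)

lemma inner_less_of_norm_le:
  fixes u w :: "'a::real_inner"
  assumes "norm u \<le> norm w" "u \<noteq> w"
  shows "u \<bullet> w < w \<bullet> w"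
proof -
  have "0 < (w - u) \<bullet> (w - u)" using assms by simp
  moreover have "u \<bullet> u \<le> w \<bullet> w" using assms(1) by (simp add: norm_le)
  ultimately show ?thesis by (simp add: inner_diff_left inner_diff_right inner_commute)
qed

lemma exp_at_bot_tendsto_0:
  fixes b :: real assumes "b < 0"
  shows "(\<lambda>n. exp (real n * b)) \<longlonglongrightarrow> 0"
proof -
  have "(\<lambda>n. exp b ^ n) \<longlonglongrightarrow> 0"
    by (rule LIMSEQ_power_zero) (use assms in auto)
  then show ?thesis by (simp add: exp_of_nat_mult)
qed

text \<open>A linear relation between the functions \<open>e\<^sup>-\<^sup>2\<^sup>\<alpha>\<^sup>i\<^sup>(\<^sup>x\<^sup>)\<close> is tested along the ray \<open>x = - n \<alpha>\<^sub>i\<close> for a vector \<open>\<alpha>\<^sub>i\<close> of maximal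
  norm among those that occur: by strict Cauchy-Schwarz its term outgrows all others, so its coefficient vanishes.\<close>

lemma span_exp_weights:
  fixes \<alpha> :: "'d::finite \<Rightarrow> real ^ 'n"
  assumes "inj \<alpha>"
  shows "span (range (exp_weights \<alpha>)) = UNIV"
proof (rule ccontr)
  assume "span (range (exp_weights \<alpha>)) \<noteq> UNIV"
  then have "dim (span (range (exp_weights \<alpha>))) < DIM(real ^ 'd)"
    using dim_eq_full[of "range (exp_weights \<alpha>)"] dim_subset_UNIV[of "range (exp_weights \<alpha>)"] by auto
  then obtain l :: "real ^ 'd" where l: "l \<noteq> 0" "\<And>y. y \<in> span (range (exp_weights \<alpha>)) \<Longrightarrow> orthogonal l y"
    using orthogonal_to_subspace_exists[of "range (exp_weights \<alpha>)"] by (metis dim_span)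
  have dep: "(\<Sum>j\<in>UNIV. l $ j * exp (-2 * (\<alpha> j \<bullet> x))) = 0" for x
    using l(2)[OF span_base, of "exp_weights \<alpha> x"] by (simp add: orthogonal_def inner_vec_def)
  define I where "I = {i. l $ i \<noteq> 0}"
  have I: "I \<noteq> {}" using l(1) by (auto simp: I_def vec_eq_iff)
  obtain i where i: "i \<in> I" and imax: "\<And>j. j \<in> I \<Longrightarrow> norm (\<alpha> j) \<le> norm (\<alpha> i)"
  proof -
    have "Max ((\<lambda>i. norm (\<alpha> i)) ` I) \<in> (\<lambda>i. norm (\<alpha> i)) ` I"
      using I by (intro Max_in) auto
    then obtain i where i: "i \<in> I" "Max ((\<lambda>i. norm (\<alpha> i)) ` I) = norm (\<alpha> i)" by auto
    have "norm (\<alpha> j) \<le> norm (\<alpha> i)" if "j \<in> I" for j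
      using that by (simp flip: i(2))
    then show ?thesis using that i(1) by blast
  qed
  have lim: "(\<lambda>n. l $ j * exp (real n * (2 * (\<alpha> j \<bullet> \<alpha> i - \<alpha> i \<bullet> \<alpha> i)))) \<longlonglongrightarrow> (if j = i then l $ i else 0)" for j
  proof (cases "j = i \<or> j \<notin> I")
    case True
    then show ?thesis by (auto simp: I_def)
  next
    case False
    then have "\<alpha> j \<bullet> \<alpha> i < \<alpha> i \<bullet> \<alpha> i"
      using imax[of j] assms by (intro inner_less_of_norm_le) (auto simp: inj_def)
    then have "(\<lambda>n. exp (real n * (2 * (\<alpha> j \<bullet> \<alpha> i - \<alpha> i \<bullet> \<alpha> i)))) \<longlonglongrightarrow> 0"
      by (intro exp_at_bot_tendsto_0) simp
    from tendsto_mult[OF tendsto_const[of "l $ j"] this] False show ?thesis by simp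
  qed
  have "(\<lambda>n. \<Sum>j\<in>UNIV. l $ j * exp (real n * (2 * (\<alpha> j \<bullet> \<alpha> i - \<alpha> i \<bullet> \<alpha> i))))
      \<longlonglongrightarrow> (\<Sum>j\<in>UNIV. if j = i then l $ i else 0)"
    by (intro tendsto_sum lim)
  moreover have "(\<Sum>j\<in>UNIV. l $ j * exp (real n * (2 * (\<alpha> j \<bullet> \<alpha> i - \<alpha> i \<bullet> \<alpha> i)))) = 0" for n
  proof -
    have "(\<Sum>j\<in>UNIV. l $ j * exp (real n * (2 * (\<alpha> j \<bullet> \<alpha> i - \<alpha> i \<bullet> \<alpha> i)))) =
        exp (- (2 * real n * (\<alpha> i \<bullet> \<alpha> i))) * (\<Sum>j\<in>UNIV. l $ j * exp (-2 * (\<alpha> j \<bullet> (- real n *\<^sub>R \<alpha> i))))"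
      by (simp add: sum_distrib_left algebra_simps exp_add[symmetric] exp_diff exp_minus field_simps)
    then show ?thesis by (simp only: dep mult_zero_right)
  qed
  ultimately have "l $ i = 0" by (simp add: LIMSEQ_const_iff)
  with i show False by (simp add: I_def)
qed

text \<open>An additive function that keeps a sign is monotone, and monotonicity squeezes it between its values at integer multiples.\<close>

lemma additive_nonneg_linear:
  fixes f :: "real \<Rightarrow> real"
  assumes add: "\<And>r s. 0 \<le> r \<Longrightarrow> 0 \<le> s \<Longrightarrow> f (r + s) = f r + f s"
    and nn: "\<And>r. 0 \<le> r \<Longrightarrow> 0 \<le> f r"
    and r: "0 \<le> r"
  shows "f r = r * f 1"
proof -
  have mono: "f x \<le> f y" if "0 \<le> x" "x \<le> y" for x y
    using add[of x "y - x"] nn[of "y - x"] that by simp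
  have f0: "f 0 = 0" using add[of 0 0] by simp
  have mult: "f (real n * x) = real n * f x" if "0 \<le> x" for n x
    using that by (induction n) (simp_all add: f0 add algebra_simps)
  have *: "real n * \<bar>f r - r * f 1\<bar> \<le> f 1" for n
  proof -
    define m where "m = nat \<lfloor>real n * r\<rfloor>"
    have m: "real m \<le> real n * r" "real n * r \<le> real m + 1"
      using r by (auto simp: m_def)
    have "real m * f 1 \<le> real n * f r"
      using mono[OF _ m(1)] mult[of 1 m] mult[of r n] r by simp
    moreover have "real n * f r \<le> (real m + 1) * f 1"
      using mono[OF _ m(2)] mult[of 1 "Suc m"] mult[of r n] r by (simp add: add.commute)
    moreover have "real m * f 1 \<le> real n * r * f 1" "real n * r * f 1 \<le> (real m + 1) * f 1"
      using m nn[of 1] by (auto intro!: mult_right_mono)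
    ultimately have "\<bar>real n * f r - real n * r * f 1\<bar> \<le> f 1"
      by (simp add: algebra_simps abs_le_iff)
    moreover have "real n * \<bar>f r - r * f 1\<bar> = \<bar>real n * f r - real n * r * f 1\<bar>"
    proof -
      have "real n * \<bar>f r - r * f 1\<bar> = \<bar>real n * (f r - r * f 1)\<bar>" by (simp only: abs_mult abs_of_nat)
      then show ?thesis by (simp add: right_diff_distrib mult.assoc)
    qed
    ultimately show ?thesis by simp
  qed
  show ?thesis
  proof (rule ccontr)
    assume "f r \<noteq> r * f 1"
    then obtain n where "real n * \<bar>f r - r * f 1\<bar> > f 1"
      using reals_Archimedean3[of "\<bar>f r - r * f 1\<bar>"] by auto
    with *[of n] show False by simp
  qed
qed

lemma orthant_add: "a \<in> orthant \<Longrightarrow> (\<And>i. 0 \<le> b $ i) \<Longrightarrow> a + b \<in> orthant"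
  by (auto simp: orthant_def add_pos_nonneg)

lemma orthant_ray:
  assumes "c \<in> orthant"
  shows "\<exists>N\<ge>0. \<forall>r\<ge>N. s + r *\<^sub>R c \<in> orthant"
proof -
  \<comment> \<open>The summand \<open>1\<close> makes the inequality strict.\<close>
  define N where "N = (\<Sum>i\<in>UNIV. \<bar>s $ i\<bar> / c $ i + 1)"
  have c: "0 < c $ i" for i using assms by (simp add: orthant_def)
  have "0 < s $ i + r * c $ i" if "N \<le> r" for i r
  proof -
    have "\<bar>s $ i\<bar> / c $ i + 1 \<le> N"
      unfolding N_def by (rule member_le_sum) (use c in \<open>auto intro!: add_nonneg_nonneg divide_nonneg_pos\<close>)
    then have "\<bar>s $ i\<bar> / c $ i < r" using that by simp
    then show ?thesis using c[of i] by (simp add: field_simps abs_less_iff) 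
  qed
  moreover have "0 \<le> N" unfolding N_def by (intro sum_nonneg) (use c in \<open>auto intro!: add_nonneg_nonneg divide_nonneg_pos\<close>)
  ultimately show ?thesis by (auto simp: orthant_def intro!: exI[of _ N])
qed

text \<open>The shifts \<open>s\<close> that change \<open>ln G\<close> by an amount independent of the base point, and all of whose multiples do so,
  form a subspace. It contains \<open>S\<close>, so it is everything, and the change \<open>q s\<close> is additive in \<open>s\<close>. Because \<open>G\<close> is
  bounded, \<open>q\<close> cannot be positive in a direction of the orthant along which one can move forever; so it is
  nonpositive there, which gives both its linearity and the sign of \<open>l\<close>.\<close>

lemma exponential_of_ray_shifts:
  fixes G :: "real ^ 'd \<Rightarrow> real" and S :: "(real ^ 'd) set"
  assumes pos: "\<And>a. a \<in> orthant \<Longrightarrow> 0 < G a"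
    and bdd: "\<And>a. a \<in> orthant \<Longrightarrow> G a \<le> C"
    and S: "S \<subseteq> orthant" and span: "span S = UNIV"
    and shift: "\<And>a a' c r. a \<in> orthant \<Longrightarrow> a' \<in> orthant \<Longrightarrow> c \<in> S \<Longrightarrow> 0 \<le> r \<Longrightarrow>
      G (a + r *\<^sub>R c) * G a' = G a * G (a' + r *\<^sub>R c)"
  obtains l :: "real ^ 'd" and K where "\<And>i. 0 \<le> l $ i" "0 < K"
    "\<And>a. a \<in> orthant \<Longrightarrow> G a = K * exp (- (l \<bullet> a))"
proof -
  define L where "L a = ln (G a)" for a
  define P where "P s q \<longleftrightarrow> (\<forall>a. a \<in> orthant \<longrightarrow> a + s \<in> orthant \<longrightarrow> L (a + s) = L a + q)" for s q
  have one: "(1::real ^ 'd) \<in> orthant" by (simp add: orthant_def)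
  have ray_orth: "a + r *\<^sub>R c \<in> orthant" if "a \<in> orthant" "c \<in> S" "0 \<le> r" for a c r
    using that S by (intro orthant_add) (auto simp: orthant_def less_imp_le)
  have P_ray: "P (r *\<^sub>R c) (L (1 + r *\<^sub>R c) - L 1)" if "c \<in> S" "0 \<le> r" for c r
  proof -
    have "L (a + r *\<^sub>R c) = L a + (L (1 + r *\<^sub>R c) - L 1)" if a: "a \<in> orthant" for a
    proof -
      have "ln (G (a + r *\<^sub>R c) * G 1) = ln (G a * G (1 + r *\<^sub>R c))"
        using shift[OF a one \<open>c \<in> S\<close> \<open>0 \<le> r\<close>] by simp
      then show ?thesis
        using pos[OF a] pos[OF one] pos[OF ray_orth[OF a \<open>c \<in> S\<close> \<open>0 \<le> r\<close>]] pos[OF ray_orth[OF one \<open>c \<in> S\<close> \<open>0 \<le> r\<close>]]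
        by (simp add: L_def ln_mult)
    qed
    then show ?thesis by (simp add: P_def)
  qed
  have P_neg: "P (- s) (- q)" if "P s q" for s q
    unfolding P_def
  proof (intro allI impI)
    fix a assume "a \<in> orthant" "a + - s \<in> orthant"
    then show "L (a + - s) = L a + - q"
      using that[unfolded P_def, rule_format, of "a - s"] by simp
  qed
  have "S \<noteq> {}" 
  proof
    assume "S = {}"
    with span have "(1::real^'d) = 0" by (metis UNIV_I span_empty singletonD)
    then show False by (metis one_neq_zero)
  qed
  then obtain c0 where c0: "c0 \<in> S" by auto
  have P_add: "P (s1 + s2) (q1 + q2)" if "P s1 q1" "P s2 q2" for s1 s2 q1 q2
    unfolding P_def
  proof (intro allI impI)
    fix a assume a: "a \<in> orthant" "a + (s1 + s2) \<in> orthant"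
    \<comment> \<open>The intermediate point \<open>a + s1\<close> may lie outside the orthant; a long shift along \<open>c0\<close> repairs that.\<close>
    obtain N where N: "0 \<le> N" "a + s1 + N *\<^sub>R c0 \<in> orthant"
      using orthant_ray[of c0 "a + s1"] c0 S by blast
    define b where "b = N *\<^sub>R c0"
    define qb where "qb = L (1 + N *\<^sub>R c0) - L 1"
    have Pb: "P b qb" using P_ray[OF c0 N(1)] by (simp add: b_def qb_def)
    have o: "a + b \<in> orthant" "a + b + s1 \<in> orthant" "a + (s1 + s2) + b \<in> orthant" "a + b + s1 + s2 \<in> orthant"
      using ray_orth[OF a(1) c0 N(1)] N(2) ray_orth[OF a(2) c0 N(1)] by (simp_all add: b_def algebra_simps)
    have "L (a + (s1 + s2) + b) = L (a + (s1 + s2)) + qb" using Pb a(2) o by (simp add: P_def)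
    moreover have "L (a + (s1 + s2) + b) = L (a + b + s1 + s2)" by (simp add: algebra_simps)
    moreover have "L (a + b + s1 + s2) = L (a + b + s1) + q2" using that(2) o by (simp add: P_def)
    moreover have "L (a + b + s1) = L (a + b) + q1" using that(1) o by (simp add: P_def)
    moreover have "L (a + b) = L a + qb" using Pb a(1) o by (simp add: P_def)
    ultimately show "L (a + (s1 + s2)) = L a + (q1 + q2)" by simp
  qed
  have P_zero: "P 0 0" by (simp add: P_def)
  define T where "T = {s. \<forall>r. \<exists>q. P (r *\<^sub>R s) q}"
  have "subspace T"
  proof (rule subspaceI)
    show "0 \<in> T" using P_zero by (auto simp: T_def)
    show "x + y \<in> T" if xy: "x \<in> T" "y \<in> T" for x y
      unfolding T_def mem_Collect_eq scaleR_add_right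
    proof
      fix r
      obtain q1 q2 where "P (r *\<^sub>R x) q1" "P (r *\<^sub>R y) q2"
        using xy unfolding T_def by blast
      then show "\<exists>q. P (r *\<^sub>R x + r *\<^sub>R y) q" using P_add by blast
    qed
    show "k *\<^sub>R x \<in> T" if "x \<in> T" for k x
      using that by (simp add: T_def)
  qed
  moreover have "S \<subseteq> T"
  proof
    fix c assume c: "c \<in> S"
    have "\<exists>q. P (r *\<^sub>R c) q" for r
      using P_ray[OF c, of r] P_neg[OF P_ray[OF c, of "- r"]] by (cases "0 \<le> r") auto
    then show "c \<in> T" by (simp add: T_def)
  qed
  ultimately have "span S \<subseteq> T" by (rule span_minimal[rotated])
  then have all: "s \<in> T" for s using span by auto
  have "\<exists>q. P s q" for s 
  proof -
    have "\<exists>q. P (1 *\<^sub>R s) q" using all[of s] unfolding T_def by blast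
    then show ?thesis by simp
  qed
  then obtain q where q: "\<And>s. P s (q s)" by metis
  have uniq: "q1 = q2" if "P s q1" "P s q2" for s q1 q2
  proof -
    obtain N where "0 \<le> N" "s + N *\<^sub>R 1 \<in> orthant" "0 + N *\<^sub>R 1 \<in> (orthant :: (real^'d) set)"
      using orthant_ray[OF one, of s] orthant_ray[OF one, of 0] by (metis linorder_linear order_trans)
    then show ?thesis using that[unfolded P_def, rule_format, of "N *\<^sub>R 1"] by (simp add: add.commute)
  qed
  have q_add: "q (s + t) = q s + q t" for s t by (rule uniq[OF q P_add[OF q q]])
  have q0: "q 0 = 0" by (rule uniq[OF q P_zero])
  have q_neg: "q (- s) = - q s" for s by (rule uniq[OF q P_neg[OF q]])
  have q_mult: "q (real n *\<^sub>R s) = real n * q s" for n s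
    by (induction n) (simp_all add: q0 q_add algebra_simps)
  \<comment> \<open>Otherwise \<open>G\<close> would grow without bound along the ray through \<open>s\<close>.\<close>
  have q_le: "q s \<le> 0" if s: "\<And>i. 0 \<le> s $ i" for s
  proof (rule ccontr)
    assume "\<not> q s \<le> 0"
    then obtain n where n: "real n * q s > ln C - L 1" using reals_Archimedean3[of "q s"] by auto
    have o: "1 + real n *\<^sub>R s \<in> orthant" using one s by (intro orthant_add) auto
    then have "L (1 + real n *\<^sub>R s) = L 1 + real n * q s"
      using q[of "real n *\<^sub>R s"] one by (simp add: P_def q_mult)
    moreover have "L (1 + real n *\<^sub>R s) \<le> ln C"
      using pos[OF o] bdd[OF o] by (simp add: L_def)
    ultimately show False using n by simp
  qed
  define l where "l = (\<chi> i. - q (axis i 1))"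
  have axis_q: "q (r *\<^sub>R axis i 1) = - r * l $ i" for r i
  proof -
    define f where "f r = - q (r *\<^sub>R axis i 1)" for r
    have f: "f r = r * f 1" if "0 \<le> r" for r
      by (rule additive_nonneg_linear[OF _ _ that])
         (auto simp: f_def scaleR_add_left q_add axis_def intro!: q_le)
    show ?thesis
    proof (cases "0 \<le> r")
      case True then show ?thesis using f[of r] by (simp add: f_def l_def)
    next
      case False
      then have "- q (- (r *\<^sub>R axis i 1)) = - r * - q (axis i 1)" using f[of "- r"] by (simp add: f_def)
      then show ?thesis by (simp add: q_neg l_def)
    qed
  qed
  have q_sum: "q (\<Sum>i\<in>I. f i) = (\<Sum>i\<in>I. q (f i))" if "finite I" for I :: "'d set" and f
    using that by (induction I rule: finite_induct) (simp_all add: q0 q_add)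
  have q_lin: "q s = - (l \<bullet> s)" for s
  proof -
    have "s = (\<Sum>i\<in>UNIV. (s $ i) *\<^sub>R axis i 1)"
      using basis_expansion[of s] by (simp add: scalar_mult_eq_scaleR)
    then have "q s = (\<Sum>i\<in>UNIV. q ((s $ i) *\<^sub>R axis i 1))" using q_sum[of UNIV] by (metis finite_UNIV finite)
    also have "\<dots> = - (l \<bullet> s)" by (simp add: axis_q inner_vec_def sum_negf mult.commute)
    finally show ?thesis .
  qed
  show ?thesis
  proof (rule that[of l "G 1 * exp (l \<bullet> 1)"])
    show "0 \<le> l $ i" for i by (simp add: l_def q_le axis_def)
    show "0 < G 1 * exp (l \<bullet> 1)" using pos[OF one] by simp
    fix a :: "real ^ 'd" assume a: "a \<in> orthant"
    have "L a = L 1 - (l \<bullet> a) + (l \<bullet> 1)"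
      using q[of "a - 1", unfolded P_def, rule_format, of 1] one a by (simp add: q_lin inner_diff_right)
    then have "exp (L a) = exp (L 1) * exp (l \<bullet> 1) * exp (- (l \<bullet> a))"
      by (simp add: exp_add[symmetric])
    then show "G a = G 1 * exp (l \<bullet> 1) * exp (- (l \<bullet> a))"
      using pos[OF a] pos[OF one] by (simp add: L_def)
  qed
qed

section \<open>Averaging against the exponential law\<close>

lemma axis_Basis_prod:
  "(\<Prod>b\<in>Basis. g b (x \<bullet> b)) = (\<Prod>i\<in>UNIV. g (axis i 1) (x $ i))" for x :: "real ^ 'd"
proof -
  have B: "Basis = range (\<lambda>i. axis i (1::real))" by (auto simp: Basis_vec_def)
  have inj: "inj (\<lambda>i::'d. axis i (1::real))" by (auto simp: inj_def axis_eq_axis)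
  show ?thesis unfolding B by (subst prod.reindex[OF inj]) (simp add: inner_axis)
qed

lemma nn_integral_vec_prod:
  fixes f :: "'d::finite \<Rightarrow> real \<Rightarrow> real"
  assumes [measurable]: "\<And>i. f i \<in> borel_measurable borel" and nn: "\<And>i x. 0 \<le> f i x"
  shows "(\<integral>\<^sup>+x. ennreal (\<Prod>i\<in>UNIV. f i (x $ i)) \<partial>(lborel :: (real ^ 'd) measure))
    = (\<Prod>i\<in>UNIV. \<integral>\<^sup>+x. f i x \<partial>lborel)"
proof -
  define ix :: "real ^ 'd \<Rightarrow> 'd" where "ix b = (THE i. b = axis i 1)" for b
  have ix: "ix (axis i 1) = i" for i by (auto simp: ix_def axis_eq_axis)
  have "(\<integral>\<^sup>+x. (\<Prod>b\<in>Basis. ennreal (f (ix b) (x \<bullet> b))) \<partial>lborel) = (\<Prod>b\<in>Basis. \<integral>\<^sup>+x. f (ix b) x \<partial>lborel)"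
    by (rule nn_integral_lborel_prod) (auto simp: nn)
  moreover have "(\<Prod>b\<in>Basis. ennreal (f (ix b) (x \<bullet> b))) = ennreal (\<Prod>i\<in>UNIV. f i (x $ i))" for x
    using axis_Basis_prod[of "\<lambda>b y. ennreal (f (ix b) y)" x] by (simp add: ix prod_ennreal nn)
  moreover have "(\<Prod>b\<in>Basis. \<integral>\<^sup>+x. f (ix b) x \<partial>lborel) = (\<Prod>i\<in>UNIV. \<integral>\<^sup>+x. f i x \<partial>lborel)"
    using axis_Basis_prod[of "\<lambda>b y. \<integral>\<^sup>+x. f (ix b) x \<partial>lborel" "0 :: real ^ 'd"] by (simp add: ix)
  ultimately show ?thesis by simp
qed

lemma sets_orthant [measurable]: "(orthant :: (real ^ 'd) set) \<in> sets borel"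
proof -
  have "open (\<Inter>i. {y :: real ^ 'd. 0 < y $ i})"
    by (intro open_INT ballI open_Collect_less continuous_intros) auto
  moreover have "orthant = (\<Inter>i. {y :: real ^ 'd. 0 < y $ i})" by (auto simp: orthant_def)
  ultimately show ?thesis by simp
qed

definition exp_law :: "(real ^ 'd) measure" where
  "exp_law = density lborel (\<lambda>b. ennreal (indicator orthant b * exp (- (1 \<bullet> b))))"

lemma sets_exp_law [measurable_cong, simp]: "sets exp_law = sets borel" "space exp_law = UNIV"
  by (simp_all add: exp_law_def)

lemma orthant_indicator_prod:
  "indicator orthant b * exp (- (1 \<bullet> b)) = (\<Prod>i\<in>UNIV. indicator {0<..} (b $ i) * exp (- (b $ i)) :: real)"
  for b :: "real ^ 'd"
proof (cases "b \<in> orthant")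
  case True
  then have "(\<Prod>i\<in>UNIV. indicator {0<..} (b $ i) * exp (- (b $ i)) :: real) = (\<Prod>i\<in>UNIV. exp (- (b $ i)))"
    by (intro prod.cong) (auto simp: orthant_def)
  also have "\<dots> = exp (- (1 \<bullet> b))" by (simp add: inner_vec_def exp_sum[symmetric] sum_negf)
  finally show ?thesis using True by simp
next
  case False
  then obtain i where "\<not> 0 < b $ i" by (auto simp: orthant_def)
  then have "(\<Prod>i\<in>UNIV. indicator {0<..} (b $ i) * exp (- (b $ i)) :: real) = 0"
    by (intro prod_zero) (auto intro!: exI[of _ i])
  then show ?thesis using False by simp
qed

lemma nn_integral_exp_law_density:
  "(\<integral>\<^sup>+b. ennreal (indicator orthant b * exp (- (1 \<bullet> b))) \<partial>(lborel :: (real ^ 'd) measure)) = 1"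
proof -
  have AE0: "AE x in lborel. x \<noteq> (0::real)" by (rule AE_lborel_singleton)
  have "(\<integral>\<^sup>+x. ennreal (indicator {0<..} x * exp (- x)) \<partial>lborel) = (\<integral>\<^sup>+x. ennreal (exponential_density 1 x) \<partial>lborel)"
    by (rule nn_integral_cong_AE) (use AE0 in eventually_elim, auto simp: exponential_density_def)
  also have "\<dots> = emeasure (density lborel (exponential_density 1)) (space (density lborel (exponential_density 1)))"
    by (simp add: emeasure_density)
  also have "\<dots> = 1"
    using prob_space.emeasure_space_1[OF prob_space_exponential_density[of 1]] by simp
  finally have one: "(\<integral>\<^sup>+x. ennreal (indicator {0<..} x * exp (- x)) \<partial>lborel) = 1" .
  show ?thesis
    unfolding orthant_indicator_prod by (subst nn_integral_vec_prod) (auto simp: one)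
qed

lemma prob_space_exp_law: "prob_space (exp_law :: (real ^ 'd) measure)"
  by (rule prob_spaceI) (simp add: exp_law_def emeasure_density nn_integral_exp_law_density)

lemma AE_exp_law_orthant: "AE b in exp_law. b \<in> orthant"
  unfolding exp_law_def by (subst AE_density) (auto simp: indicator_def)

text \<open>Up to the factor \<open>e\<^sup>-\<^sup>a\<close> this is the density of the exponential law translated by \<open>a\<close>. Leaving the exponential
  untranslated makes the weights decrease in \<open>a\<close>.\<close>

definition upper_weight :: "real ^ 'd \<Rightarrow> real ^ 'd \<Rightarrow> real" where
  "upper_weight a b = indicator orthant (b - a) * exp (- (1 \<bullet> b))"

lemma upper_weight_measurable [measurable]: "upper_weight a \<in> borel_measurable borel"
  unfolding upper_weight_def by measurable

lemma upper_weight_nonneg: "0 \<le> upper_weight a b" by (simp add: upper_weight_def)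

lemma nn_integral_shift_lborel:
  fixes f :: "real ^ 'd \<Rightarrow> ennreal"
  assumes [measurable]: "f \<in> borel_measurable borel"
  shows "(\<integral>\<^sup>+b. f (a + b) \<partial>lborel) = (\<integral>\<^sup>+b. f b \<partial>lborel)"
  by (subst (2) lborel_distr_plus[of a, symmetric]) (simp add: nn_integral_distr)

lemma integral_shift_lborel:
  fixes f :: "real ^ 'd \<Rightarrow> real"
  assumes [measurable]: "f \<in> borel_measurable borel"
  shows "(\<integral>b. f (a + b) \<partial>lborel) = (\<integral>b. f b \<partial>lborel)"
  by (subst (2) lborel_distr_plus[of a, symmetric]) (simp add: integral_distr)

lemma upper_weight_shift: "upper_weight a (a + b) = exp (- (1 \<bullet> a)) * (indicator orthant b * exp (- (1 \<bullet> b)))"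
  by (simp add: upper_weight_def inner_add_right exp_add[symmetric])

lemma nn_integral_upper_weight:
  fixes a :: "real ^ 'd"
  shows "(\<integral>\<^sup>+b. ennreal (upper_weight a b) \<partial>lborel) = ennreal (exp (- (1 \<bullet> a)))"
proof -
  have "(\<integral>\<^sup>+b. ennreal (upper_weight a b) \<partial>lborel) = (\<integral>\<^sup>+b. ennreal (upper_weight a (a + b)) \<partial>lborel)"
    by (rule nn_integral_shift_lborel[symmetric]) measurable
  also have "\<dots> = (\<integral>\<^sup>+b. ennreal (exp (- (1 \<bullet> a))) * ennreal (indicator orthant b * exp (- (1 \<bullet> b)))
      \<partial>(lborel :: (real ^ 'd) measure))"
    by (simp only: upper_weight_shift ennreal_mult'[OF exp_ge_zero])
  also have "\<dots> = ennreal (exp (- (1 \<bullet> a)))"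
    by (subst nn_integral_cmult) (auto simp only: nn_integral_exp_law_density mult_1_right, measurable)
  finally show ?thesis .
qed

lemma integrable_upper_weight: "integrable lborel (upper_weight a)"
  by (rule integrableI_nonneg) (auto simp: upper_weight_nonneg nn_integral_upper_weight)

lemma integral_upper_weight: "(\<integral>b. upper_weight a b \<partial>lborel) = exp (- (1 \<bullet> a))"
  by (rule integral_eq_nn_integral[THEN trans]) (auto simp: upper_weight_nonneg nn_integral_upper_weight)

text \<open>The exponential kernel is chosen because it combines three properties: it smooths enough to make the average of a
  bounded function Lipschitz, it maps exponentials to multiples of themselves, and it can be inverted.\<close>

definition exp_average :: "(real ^ 'd \<Rightarrow> real) \<Rightarrow> real ^ 'd \<Rightarrow> real" where
  "exp_average v a = (\<integral>b. v (a + b) \<partial>exp_law)"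

text \<open>Written this way, averages at different points integrate \<open>v\<close> against one and the same weight \<open>e\<^sup>-\<^sup>b\<close>, over varying orthants.\<close>

lemma exp_average_eq:
  fixes v :: "real ^ 'd \<Rightarrow> real"
  assumes [measurable]: "v \<in> borel_measurable borel"
  shows "exp_average v a = exp (1 \<bullet> a) * (\<integral>b. upper_weight a b * v b \<partial>lborel)"
proof -
  have "(\<integral>b. upper_weight a b * v b \<partial>lborel) = (\<integral>b. upper_weight a (a + b) * v (a + b) \<partial>lborel)"
    by (rule integral_shift_lborel[symmetric]) measurable
  also have "\<dots> = exp (- (1 \<bullet> a)) * (\<integral>b. (indicator orthant b * exp (- (1 \<bullet> b))) * v (a + b) \<partial>lborel)"
    by (simp add: upper_weight_shift mult.assoc)
  also have "(\<integral>b. (indicator orthant b * exp (- (1 \<bullet> b))) * v (a + b) \<partial>lborel) = exp_average v a"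
    unfolding exp_average_def exp_law_def by (subst integral_density) auto
  finally show ?thesis by (simp add: exp_minus)
qed

locale bounded_weight =
  fixes v :: "real ^ 'd \<Rightarrow> real" and C :: real
  assumes v_meas [measurable]: "v \<in> borel_measurable borel"
    and v_nonneg: "\<And>y. 0 \<le> v y" and v_le: "\<And>y. v y \<le> C"
begin

lemma C_nonneg: "0 \<le> C" using v_nonneg[of 0] v_le[of 0] by simp

lemma integrable_upper_weight_v: "integrable lborel (\<lambda>b. upper_weight a b * v b)"
  by (rule Bochner_Integration.integrable_bound[OF integrable_mult_right[OF integrable_upper_weight[of a], of C]])
     (auto simp: upper_weight_nonneg v_nonneg v_le C_nonneg abs_mult mult.commute intro!: mult_right_mono)

lemma integrable_v_exp_law: "integrable exp_law (\<lambda>b. v (a + b))"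
proof -
  interpret prob_space "exp_law :: (real ^ 'd) measure" by (rule prob_space_exp_law)
  show ?thesis by (rule integrable_const_bound[of _ C]) (auto simp: v_nonneg v_le)
qed

lemma exp_average_nonneg: "0 \<le> exp_average v a"
  unfolding exp_average_def by (rule integral_nonneg_AE) (simp add: v_nonneg)

lemma exp_average_le: "exp_average v a \<le> C"
proof -
  interpret prob_space "exp_law :: (real ^ 'd) measure" by (rule prob_space_exp_law)
  have "exp_average v a \<le> (\<integral>b. C \<partial>(exp_law :: (real ^ 'd) measure))"
    unfolding exp_average_def by (rule Bochner_Integration.integral_mono) (auto simp: integrable_v_exp_law v_le)
  then show ?thesis using prob_space by simp
qed

text \<open>The upper orthants with corners \<open>a \<le> a'\<close> are nested, so the integrals of \<open>v\<close> differ by at most \<open>C\<close> times the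
  difference of the integrals of the weights, which are explicit.\<close>

lemma exp_average_lipschitz_le:
  assumes le: "\<And>i. a $ i \<le> a' $ i"
  shows "\<bar>exp_average v a - exp_average v a'\<bar> \<le> C * (1 \<bullet> (a' - a))"
proof -
  define D where "D = 1 \<bullet> (a' - a)"
  have D: "0 \<le> D" unfolding D_def inner_vec_def by (intro sum_nonneg) (simp add: le)
  let ?m = "\<lambda>a. \<integral>b. upper_weight a b * v b \<partial>lborel"
  have upper_weight_le: "upper_weight a' b \<le> upper_weight a b" for b
  proof -
    have "b - a \<in> orthant" if "b - a' \<in> orthant"
      unfolding orthant_def
    proof safe
      fix i
      have "0 < (b - a') $ i" using that by (simp add: orthant_def)
      then show "0 < (b - a) $ i" using le[of i] by simp
    qed
    then show ?thesis by (auto simp: upper_weight_def indicator_def)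
  qed
  have m1: "?m a' \<le> ?m a"
    by (rule Bochner_Integration.integral_mono[OF integrable_upper_weight_v integrable_upper_weight_v]) (auto intro!: mult_right_mono upper_weight_le v_nonneg)
  have "?m a - ?m a' = (\<integral>b. (upper_weight a b - upper_weight a' b) * v b \<partial>lborel)"
    by (subst Bochner_Integration.integral_diff[symmetric]) (auto simp: integrable_upper_weight_v left_diff_distrib)
  also have "\<dots> \<le> (\<integral>b. (upper_weight a b - upper_weight a' b) * C \<partial>lborel)"
  proof (rule Bochner_Integration.integral_mono)
    show "integrable lborel (\<lambda>b. (upper_weight a b - upper_weight a' b) * v b)"
      using integrable_upper_weight_v[of a] integrable_upper_weight_v[of a'] by (simp add: left_diff_distrib)
    show "integrable lborel (\<lambda>b. (upper_weight a b - upper_weight a' b) * C)"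
      using integrable_upper_weight[of a] integrable_upper_weight[of a'] by (simp add: left_diff_distrib)
    show "(upper_weight a b - upper_weight a' b) * v b \<le> (upper_weight a b - upper_weight a' b) * C" for b
      by (rule mult_left_mono) (simp_all add: upper_weight_le v_le)
  qed
  also have "\<dots> = C * (exp (- (1 \<bullet> a)) - exp (- (1 \<bullet> a')))"
    using integrable_upper_weight[of a] integrable_upper_weight[of a'] by (simp add: integral_upper_weight)
  finally have m2: "?m a - ?m a' \<le> C * (exp (- (1 \<bullet> a)) - exp (- (1 \<bullet> a')))" .
  have m3: "?m a' \<le> C * exp (- (1 \<bullet> a'))" 
  proof -
    have "?m a' \<le> (\<integral>b. upper_weight a' b * C \<partial>lborel)"
      using integrable_upper_weight_v[of a'] integrable_upper_weight[of a']
      by (intro Bochner_Integration.integral_mono) (auto intro!: mult_left_mono simp: upper_weight_nonneg v_le)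
    then show ?thesis by (simp add: integral_upper_weight mult.commute)
  qed
  have m4: "0 \<le> ?m a'" by (rule integral_nonneg_AE) (simp add: upper_weight_nonneg v_nonneg)
  have ea: "exp (1 \<bullet> a') = exp (1 \<bullet> a) * exp D" by (simp add: D_def exp_add[symmetric] inner_diff_right)
  have "exp (1 \<bullet> a) * (?m a - ?m a') \<le> exp (1 \<bullet> a) * (C * (exp (- (1 \<bullet> a)) - exp (- (1 \<bullet> a'))))"
    using m2 by (intro mult_left_mono) auto
  also have "\<dots> = C * (1 - exp (- D))"
    by (simp add: D_def algebra_simps inner_diff_right exp_diff exp_minus divide_inverse)
  finally have t1: "exp (1 \<bullet> a) * (?m a - ?m a') \<le> C * (1 - exp (- D))" .
  have "(exp (1 \<bullet> a') - exp (1 \<bullet> a)) * ?m a' \<le> (exp (1 \<bullet> a') - exp (1 \<bullet> a)) * (C * exp (- (1 \<bullet> a')))"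
    using m3 D by (intro mult_left_mono) (auto simp: D_def inner_diff_right)
  also have "\<dots> = C * (1 - exp (- D))"
    by (simp add: D_def algebra_simps inner_diff_right exp_diff exp_minus divide_inverse)
  finally have t2: "(exp (1 \<bullet> a') - exp (1 \<bullet> a)) * ?m a' \<le> C * (1 - exp (- D))" .
  have t3: "0 \<le> (exp (1 \<bullet> a') - exp (1 \<bullet> a)) * ?m a'"
    using m4 D by (intro mult_nonneg_nonneg) (auto simp: D_def inner_diff_right)
  have t4: "0 \<le> exp (1 \<bullet> a) * (?m a - ?m a')" using m1 by simp
  have "exp_average v a - exp_average v a' = exp (1 \<bullet> a) * (?m a - ?m a') - (exp (1 \<bullet> a') - exp (1 \<bullet> a)) * ?m a'"
    by (simp add: exp_average_eq algebra_simps)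
  then have "\<bar>exp_average v a - exp_average v a'\<bar> \<le> C * (1 - exp (- D))"
    using t1 t2 t3 t4 by linarith
  also have "\<dots> \<le> C * D" using C_nonneg exp_ge_add_one_self[of "- D"] by (intro mult_left_mono) auto
  finally show ?thesis by (simp add: D_def)
qed

text \<open>The comparison through the componentwise minimum reduces the estimate to ordered pairs of points.\<close>

lemma exp_average_lipschitz: "\<bar>exp_average v a - exp_average v a'\<bar> \<le> C * (\<Sum>i\<in>UNIV. \<bar>a $ i - a' $ i\<bar>)"
proof -
  define w where "w = (\<chi> i. min (a $ i) (a' $ i))"
  have 1: "\<bar>exp_average v w - exp_average v a\<bar> \<le> C * (1 \<bullet> (a - w))" "\<bar>exp_average v w - exp_average v a'\<bar> \<le> C * (1 \<bullet> (a' - w))"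
    by (auto intro!: exp_average_lipschitz_le simp: w_def)
  have "1 \<bullet> (a - w) + 1 \<bullet> (a' - w) = (\<Sum>i\<in>UNIV. \<bar>a $ i - a' $ i\<bar>)"
    unfolding inner_vec_def sum.distrib[symmetric] by (rule sum.cong) (auto simp: w_def)
  then have "C * (1 \<bullet> (a - w)) + C * (1 \<bullet> (a' - w)) = C * (\<Sum>i\<in>UNIV. \<bar>a $ i - a' $ i\<bar>)"
    by (metis distrib_left)
  with 1 show ?thesis by linarith
qed

lemma exp_average_tendsto:
  assumes "(f \<longlongrightarrow> a) F"
  shows "((\<lambda>x. exp_average v (f x)) \<longlongrightarrow> exp_average v a) F"
proof -
  have "((\<lambda>x. C * (\<Sum>i\<in>UNIV. \<bar>f x $ i - a $ i\<bar>)) \<longlongrightarrow> C * (\<Sum>i\<in>UNIV. \<bar>a $ i - a $ i\<bar>)) F"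
    by (intro tendsto_intros assms)
  then have "((\<lambda>x. C * (\<Sum>i\<in>UNIV. \<bar>f x $ i - a $ i\<bar>)) \<longlongrightarrow> 0) F" by simp
  then have "((\<lambda>x. exp_average v (f x) - exp_average v a) \<longlongrightarrow> 0) F"
    by (rule Lim_null_comparison[rotated]) (simp add: exp_average_lipschitz)
  then show ?thesis by (simp add: LIM_zero_iff)
qed

lemma exp_average_measurable [measurable]: "exp_average v \<in> borel_measurable borel"
  by (rule borel_measurable_continuous_onI)
     (auto simp: continuous_on_def intro!: exp_average_tendsto tendsto_ident_at)

end

text \<open>The averages are, up to a factor depending on \<open>a\<close> only, the masses of upper orthants under the finite measures
  with densities \<open>e\<^sup>-\<^sup>b u(b)\<close> and \<open>e\<^sup>-\<^sup>b v(b)\<close>. Upper orthants are stable under intersection and generate the Borel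
  sets, so the two measures agree.\<close>

lemma exp_average_determines:
  fixes u v :: "real ^ 'd \<Rightarrow> real"
  assumes u: "bounded_weight u Cu" and v: "bounded_weight v Cv"
    and u0: "\<And>y. y \<notin> orthant \<Longrightarrow> u y = 0" and v0: "\<And>y. y \<notin> orthant \<Longrightarrow> v y = 0"
    and eq: "\<And>a. a \<in> orthant \<Longrightarrow> exp_average u a = exp_average v a"
  shows "AE y in lborel. u y = v y"
proof -
  interpret u: bounded_weight u Cu by (rule u)
  interpret v: bounded_weight v Cv by (rule v)
  \<comment> \<open>By continuity the assumption extends to the closed orthant.\<close>
  have eq': "exp_average u a = exp_average v a" if "\<And>i. 0 \<le> a $ i" for a
  proof -
    have lim: "(\<lambda>n. a + (1 / real (Suc n)) *\<^sub>R 1) \<longlonglongrightarrow> a"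
      using tendsto_add[OF tendsto_const[of a] tendsto_scaleR[OF LIMSEQ_inverse_real_of_nat tendsto_const[of 1]]]
      by (simp add: divide_inverse)
    have "a + (1 / real (Suc n)) *\<^sub>R 1 \<in> orthant" for n
      using that by (auto simp: orthant_def add_nonneg_pos)
    then have "exp_average u (a + (1 / real (Suc n)) *\<^sub>R 1) = exp_average v (a + (1 / real (Suc n)) *\<^sub>R 1)" for n
      by (rule eq)
    then show ?thesis using u.exp_average_tendsto[OF lim] v.exp_average_tendsto[OF lim] LIMSEQ_unique by auto
  qed
  define mu where "mu f = density lborel (\<lambda>b. ennreal (exp (- (1 \<bullet> b)) * f b))" for f :: "real ^ 'd \<Rightarrow> real"
  define E where "E = range (\<lambda>a :: real ^ 'd. {b. b - a \<in> orthant})"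
  have E_borel: "range (\<lambda>a :: real ^ 'd. {x. eucl_less a x}) = E"
    unfolding E_def by (rule arg_cong[where f = range])
      (auto simp: fun_eq_iff eucl_less_def orthant_def Basis_vec_def inner_axis set_eq_iff)
  have sets_E: "sets borel = sigma_sets UNIV E"
    by (subst borel_eq_greaterThan) (simp add: E_borel sets_measure_of)
  \<comment> \<open>Since \<open>f\<close> vanishes off the orthant, a corner may be moved into its closure.\<close>
  have em: "emeasure (mu f) {b. b - a \<in> orthant} = ennreal (\<integral>b. upper_weight (\<chi> i. max 0 (a $ i)) b * f b \<partial>lborel)"
    if "bounded_weight f Cf" "\<And>y. y \<notin> orthant \<Longrightarrow> f y = 0" for f Cf a
  proof -
    interpret f: bounded_weight f Cf by (rule that)
    have [measurable]: "f \<in> borel_measurable borel" by (rule f.v_meas)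
    have "{b. b - a \<in> orthant} = (\<lambda>b. b - a) -` orthant \<inter> space borel" by auto
    then have [measurable]: "{b. b - a \<in> orthant} \<in> sets borel"
      using measurable_sets[of "\<lambda>b. b - a" borel borel orthant] by simp
    have "b - a \<in> orthant \<and> b \<in> orthant \<longleftrightarrow> b - (\<chi> i. max 0 (a $ i)) \<in> orthant" for b
      by (auto simp: orthant_def)
    then have iff: "b - (\<chi> i. max 0 (a $ i)) \<in> orthant \<longleftrightarrow> b - a \<in> orthant \<and> b \<in> orthant" for b
      by blast
    have "ennreal (exp (- (1 \<bullet> b)) * f b) * indicator {b. b - a \<in> orthant} b
        = ennreal (upper_weight (\<chi> i. max 0 (a $ i)) b * f b)" for b
      using that(2)[of b] unfolding upper_weight_def indicator_def iff by (cases "b \<in> orthant") auto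
    then have "emeasure (mu f) {b. b - a \<in> orthant} = (\<integral>\<^sup>+b. ennreal (upper_weight (\<chi> i. max 0 (a $ i)) b * f b) \<partial>lborel)"
      unfolding mu_def by (subst emeasure_density) auto
    also have "\<dots> = ennreal (\<integral>b. upper_weight (\<chi> i. max 0 (a $ i)) b * f b \<partial>lborel)"
      by (intro nn_integral_eq_integral f.integrable_upper_weight_v) (simp add: upper_weight_nonneg f.v_nonneg)
    finally show ?thesis .
  qed
  have "mu u = mu v"
  proof (rule measure_eqI_generator_eq[where \<Omega> = UNIV and E = E and A = "\<lambda>n. {b. b - (- real n *\<^sub>R 1) \<in> orthant}"])
    show "Int_stable E"
    proof (rule Int_stableI)
      fix X Y assume "X \<in> E" "Y \<in> E"
      then obtain a a' where "X = {b. b - a \<in> orthant}" "Y = {b. b - a' \<in> orthant}" by (auto simp: E_def)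
      then have "X \<inter> Y = {b. b - (\<chi> i. max (a $ i) (a' $ i)) \<in> orthant}" by (auto simp: orthant_def)
      then show "X \<inter> Y \<in> E" by (auto simp: E_def)
    qed
    show "emeasure (mu u) X = emeasure (mu v) X" if XE: "X \<in> E" for X
    proof -
      obtain a where X: "X = {b. b - a \<in> orthant}" using XE by (auto simp: E_def)
      have "exp_average u (\<chi> i. max 0 (a $ i)) = exp_average v (\<chi> i. max 0 (a $ i))" by (rule eq') simp
      then have *: "(\<integral>b. upper_weight (\<chi> i. max 0 (a $ i)) b * u b \<partial>lborel) = (\<integral>b. upper_weight (\<chi> i. max 0 (a $ i)) b * v b \<partial>lborel)"
        by (simp add: exp_average_eq)
      have "emeasure (mu u) {b. b - a \<in> orthant} = emeasure (mu v) {b. b - a \<in> orthant}"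
        using em[OF u u0, of a] em[OF v v0, of a] * by simp
      then show ?thesis by (simp only: X)
    qed
    show "(\<Union>n. {b. b - (- real n *\<^sub>R 1) \<in> orthant}) = (UNIV :: (real ^ 'd) set)"
    proof (rule UNIV_eq_I[symmetric])
      fix b :: "real ^ 'd"
      obtain N where "\<forall>r\<ge>N. b + r *\<^sub>R 1 \<in> orthant" using orthant_ray[of 1 b] by (auto simp: orthant_def)
      moreover obtain n where "N \<le> real n" using real_arch_simple by blast
      ultimately show "b \<in> (\<Union>n. {b. b - (- real n *\<^sub>R 1) \<in> orthant})" by auto
    qed
    show "emeasure (mu u) {b. b - (- real n *\<^sub>R 1) \<in> orthant} \<noteq> \<infinity>" for n
      by (subst em[OF u u0]) auto
    show "range (\<lambda>n. {b. b - (- real n *\<^sub>R 1) \<in> orthant}) \<subseteq> E"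
      unfolding E_def by (intro image_subsetI rangeI)
  qed (simp_all add: mu_def sets_E)
  then have "AE b in lborel. ennreal (exp (- (1 \<bullet> b)) * u b) = ennreal (exp (- (1 \<bullet> b)) * v b)"
    unfolding mu_def by (intro sigma_finite_measure.density_unique[OF sigma_finite_lborel]) auto
  then show ?thesis
    by eventually_elim (simp add: u.v_nonneg v.v_nonneg)
qed

lemma exp_average_bounded_weight:
  assumes "bounded_weight v C"
  shows "bounded_weight (exp_average v) C"
proof -
  interpret v: bounded_weight v C by (rule assms)
  show ?thesis by unfold_locales (auto simp: v.exp_average_nonneg v.exp_average_le)
qed

lemma exp_average_pos:
  fixes v :: "real ^ 'd \<Rightarrow> real"
  assumes "bounded_weight v C" and "\<And>y. y \<in> orthant \<Longrightarrow> 0 < v y" and "a \<in> orthant"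
  shows "0 < exp_average v a"
proof -
  interpret v: bounded_weight v C by (rule assms(1))
  interpret E: prob_space "exp_law :: (real ^ 'd) measure" by (rule prob_space_exp_law)
  show ?thesis
    unfolding exp_average_def
  proof (rule E.expectation_greater[OF v.integrable_v_exp_law])
    show "AE b in exp_law. 0 < v (a + b)"
      using AE_exp_law_orthant
    proof eventually_elim
      case (elim b)
      have "a + b \<in> orthant" by (rule orthant_add[OF assms(3)]) (use elim in \<open>auto simp: orthant_def less_imp_le\<close>)
      then show ?case by (rule assms(2))
    qed
  qed
qed

lemma exp_average_exp:
  fixes l :: "real ^ 'd"
  assumes l: "\<And>i. 0 \<le> l $ i"
  obtains k where "0 < k" "\<And>a. a \<in> orthant \<Longrightarrow> exp_average (\<lambda>y. indicator orthant y * exp (- (l \<bullet> y))) a = k * exp (- (l \<bullet> a))"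
proof
  interpret E: prob_space "exp_law :: (real ^ 'd) measure" by (rule prob_space_exp_law)
  have int: "integrable exp_law (\<lambda>b :: real ^ 'd. exp (- (l \<bullet> b)))"
  proof (rule E.integrable_const_bound[of _ 1])
    show "AE b in exp_law. norm (exp (- (l \<bullet> b))) \<le> 1"
      using AE_exp_law_orthant
    proof eventually_elim
      case (elim b)
      have "0 \<le> l \<bullet> b" unfolding inner_vec_def
        by (intro sum_nonneg) (use l elim in \<open>auto simp: orthant_def less_imp_le\<close>)
      then show ?case by simp
    qed
  qed simp
  show "0 < (\<integral>b. exp (- (l \<bullet> b)) \<partial>exp_law)" by (rule E.expectation_greater[OF int]) simp
  fix a :: "real ^ 'd" assume a: "a \<in> orthant"
  have "exp_average (\<lambda>y. indicator orthant y * exp (- (l \<bullet> y))) a = (\<integral>b. exp (- (l \<bullet> a)) * exp (- (l \<bullet> b)) \<partial>exp_law)"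
    unfolding exp_average_def
  proof (rule integral_cong_AE)
    show "AE b in exp_law. indicator orthant (a + b) * exp (- (l \<bullet> (a + b))) = exp (- (l \<bullet> a)) * exp (- (l \<bullet> b))"
      using AE_exp_law_orthant
    proof eventually_elim
      case (elim b)
      have "a + b \<in> orthant" by (rule orthant_add[OF a]) (use elim in \<open>auto simp: orthant_def less_imp_le\<close>)
      then show ?case by (simp add: inner_add_right exp_add[symmetric])
    qed
  qed measurable
  then show "exp_average (\<lambda>y. indicator orthant y * exp (- (l \<bullet> y))) a = (\<integral>b. exp (- (l \<bullet> b)) \<partial>exp_law) * exp (- (l \<bullet> a))"
    by (simp add: mult.commute)
qed

section \<open>Riemann sums and Gaussian integrals\<close>

lemma tendsto_vec_times [tendsto_intros]:
  fixes f g :: "'a \<Rightarrow> real ^ 'd"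
  assumes "(f \<longlongrightarrow> a) F" "(g \<longlongrightarrow> b) F"
  shows "((\<lambda>x. f x * g x) \<longlongrightarrow> a * b) F"
  by (rule vec_tendstoI) (simp, intro tendsto_intros assms)

lemma borel_measurable_vecI:
  fixes f :: "'a \<Rightarrow> real ^ 'd"
  assumes "\<And>i. (\<lambda>x. f x $ i) \<in> borel_measurable M"
  shows "f \<in> borel_measurable M"
  by (subst borel_measurable_euclidean_space) (auto simp: Basis_vec_def inner_axis assms)

lemma borel_measurable_vec_nth [measurable (raw)]:
  fixes f :: "'a \<Rightarrow> real ^ 'd"
  assumes [measurable]: "f \<in> borel_measurable M"
  shows "(\<lambda>x. f x $ i) \<in> borel_measurable M"
proof -
  have "(\<lambda>x. f x \<bullet> axis i 1) \<in> borel_measurable M" by measurable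
  then show ?thesis by (simp add: inner_axis)
qed

lemma borel_measurable_vec_times [measurable]:
  fixes f g :: "'a \<Rightarrow> real ^ 'd"
  assumes [measurable]: "f \<in> borel_measurable M" "g \<in> borel_measurable M"
  shows "(\<lambda>x. f x * g x) \<in> borel_measurable M"
  by (rule borel_measurable_vecI) (simp, measurable)

lemma borel_measurable_exp_weights [measurable (raw)]:
  assumes [measurable]: "f \<in> borel_measurable M"
  shows "(\<lambda>x. exp_weights \<alpha> (f x)) \<in> borel_measurable M"
  by (rule borel_measurable_vecI) simp

lemma tendsto_exp_weights [tendsto_intros]:
  assumes "(f \<longlongrightarrow> a) F"
  shows "((\<lambda>x. exp_weights \<alpha> (f x)) \<longlongrightarrow> exp_weights \<alpha> a) F"
  by (rule vec_tendstoI) (simp, intro tendsto_intros assms)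

lemma riemann_sum_tendsto:
  fixes f :: "real \<Rightarrow> real"
  assumes T: "0 \<le> T" and f: "continuous_on {0..T} f"
  shows "(\<lambda>N. T / real N * (\<Sum>k<N. f (real k * (T / real N)))) \<longlonglongrightarrow> integral {0..T} f"
proof (rule LIMSEQ_I)
  fix e :: real assume e: "0 < e"
  define e' where "e' = e / (2 * (T + 1))"
  have e': "0 < e'" "e' * T < e" using e T by (auto simp: e'_def field_simps intro: add_nonneg_pos)
  have "uniformly_continuous_on {0..T} f"
    by (rule compact_uniformly_continuous[OF f]) simp
  then obtain d where d: "0 < d" "\<And>x y. x \<in> {0..T} \<Longrightarrow> y \<in> {0..T} \<Longrightarrow> \<bar>y - x\<bar> < d \<Longrightarrow> \<bar>f y - f x\<bar> < e'"
    using e'(1) unfolding uniformly_continuous_on_def dist_real_def by metis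
  obtain N0 where N0: "T / d < real N0" using reals_Archimedean2 by blast
  show "\<exists>N0. \<forall>N\<ge>N0. norm (T / real N * (\<Sum>k<N. f (real k * (T / real N))) - integral {0..T} f) < e"
  proof (intro exI[of _ "max 1 N0"] allI impI)
    fix N assume N: "max 1 N0 \<le> N"
    define h where "h = T / real N"
    have h: "0 \<le> h" "h < d" "real N * h = T"
    proof -
      have "T / d < real N" using N0 N by (meson less_le_trans max.bounded_iff of_nat_le_iff)
      then show "0 \<le> h" "h < d" "real N * h = T" using T d(1) N by (auto simp: h_def field_simps)
    qed
    have int: "f integrable_on {0..T}" using f by (rule integrable_continuous_real)
    have "\<bar>integral {0..real j * h} f - h * (\<Sum>k<j. f (real k * h))\<bar> \<le> e' * (real j * h)" if "j \<le> N" for j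
      using that
    proof (induction j)
      case (Suc j)
      have le: "real (Suc j) * h \<le> T" using Suc.prems h mult_right_mono[of "real (Suc j)" "real N" h] by simp
      have j: "0 \<le> real j * h" "real j * h \<le> real (Suc j) * h" using h(1) by (auto simp: algebra_simps)
      have sub: "{0..real (Suc j) * h} \<subseteq> {0..T}" "{real j * h..real (Suc j) * h} \<subseteq> {0..T}" using le j by auto
      have c: "continuous_on {real j * h..real (Suc j) * h} f" by (rule continuous_on_subset[OF f sub(2)])
      have "integral {0..real (Suc j) * h} f = integral {0..real j * h} f + integral {real j * h..real (Suc j) * h} f"
        using Henstock_Kurzweil_Integration.integral_combine[OF j integrable_on_subinterval[OF int sub(1)]] by simp
      moreover have "integral {real j * h..real (Suc j) * h} f - h * f (real j * h) =
          integral {real j * h..real (Suc j) * h} (\<lambda>x. f x - f (real j * h))"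
        using j integrable_continuous_real[OF c]
        by (subst Henstock_Kurzweil_Integration.integral_diff) (auto simp: algebra_simps)
      moreover have "norm (integral {real j * h..real (Suc j) * h} (\<lambda>x. f x - f (real j * h)))
          \<le> e' * (real (Suc j) * h - real j * h)"
      proof (rule integral_bound[OF j(2)])
        show "continuous_on {real j * h..real (Suc j) * h} (\<lambda>x. f x - f (real j * h))"
          by (intro continuous_intros c)
        fix x assume x: "x \<in> {real j * h..real (Suc j) * h}"
        then have "\<bar>x - real j * h\<bar> < d" using h by (auto simp: algebra_simps)
        then show "norm (f x - f (real j * h)) \<le> e'"
          using d(2)[of "real j * h" x] x sub j le by auto
      qed
      moreover have "\<bar>integral {0..real j * h} f - h * (\<Sum>k<j. f (real k * h))\<bar> \<le> e' * (real j * h)"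
        using Suc by simp
      moreover have "e' * (real (Suc j) * h) = e' * (real j * h) + e' * (real (Suc j) * h - real j * h)"
        by (simp add: algebra_simps)
      ultimately show ?case by (simp only: sum.lessThan_Suc distrib_left real_norm_def)
    qed simp
    from this[of N] show "norm (T / real N * (\<Sum>k<N. f (real k * (T / real N))) - integral {0..T} f) < e"
      using e' h unfolding h_def[symmetric] by (simp add: abs_minus_commute)
  qed
qed

text \<open>The mesh \<open>t / N\<close> is tied to \<open>t\<close> and not to the length \<open>m t\<close> of the interval, so that \<open>t\<close> is always a grid point and
  the sums can be split there.\<close>

lemma riemann_sum_tendsto_mult:
  fixes f :: "real \<Rightarrow> real"
  assumes t: "0 < t" and f: "continuous_on {0..} f" and m: "0 < m"
  shows "(\<lambda>N. t / real N * (\<Sum>k<m * N. f (real k * (t / real N)))) \<longlonglongrightarrow> integral {0..real m * t} f"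
proof -
  have lim: "filterlim (\<lambda>N. m * N) at_top sequentially"
    using m by (auto simp: filterlim_at_top intro!: eventually_sequentiallyI le_trans[OF _ mult_le_mono1[of 1 m]])
  have eq: "real m * t / real (m * N) = t / real N" for N using m by simp
  have "(\<lambda>N. real m * t / real N * (\<Sum>k<N. f (real k * (real m * t / real N)))) \<longlonglongrightarrow> integral {0..real m * t} f"
    by (rule riemann_sum_tendsto) (use t in \<open>auto intro: continuous_on_subset[OF f]\<close>)
  from filterlim_compose[OF this lim] show ?thesis by (simp only: eq)
qed

text \<open>Completing the square.\<close>

lemma nn_integral_exp_normal:
  fixes k :: real assumes s: "0 < s"
  shows "(\<integral>\<^sup>+x. ennreal (exp (k * x) * normal_density 0 (sqrt s) x) \<partial>lborel) = ennreal (exp (k\<^sup>2 * s / 2))"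
proof -
  have eq: "exp (k * x) * normal_density 0 (sqrt s) x = exp (k\<^sup>2 * s / 2) * normal_density (k * s) (sqrt s) x" for x
  proof -
    have "k * x + - (x\<^sup>2) / (2 * s) = k\<^sup>2 * s / 2 + - ((x - k * s)\<^sup>2) / (2 * s)"
      using s by (simp add: field_simps power2_eq_square)
    then show ?thesis using s unfolding normal_density_def
      by (simp add: exp_add[symmetric])
  qed
  interpret prob_space "density lborel (normal_density (k * s) (sqrt s))"
    by (rule prob_space_normal_density) (use s in simp)
  have "(\<integral>\<^sup>+x. ennreal (normal_density (k * s) (sqrt s) x) \<partial>lborel) = 1"
    using emeasure_space_1 by (simp add: emeasure_density)
  then show ?thesis unfolding eq by (simp add: ennreal_mult' nn_integral_cmult)
qed

lemma nn_integral_exp_normal_vec: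
  fixes k :: "real ^ 'n" assumes s: "0 < s"
  shows "(\<integral>\<^sup>+x. ennreal (\<Prod>j\<in>UNIV. normal_density 0 (sqrt s) (x $ j)) * ennreal (exp (k \<bullet> x)) \<partial>lborel)
    = ennreal (exp ((k \<bullet> k) * s / 2))"
proof -
  have "ennreal (\<Prod>j\<in>UNIV. normal_density 0 (sqrt s) (x $ j)) * ennreal (exp (k \<bullet> x))
      = ennreal (\<Prod>j\<in>UNIV. exp (k $ j * x $ j) * normal_density 0 (sqrt s) (x $ j))" for x
    by (simp add: ennreal_mult'[symmetric] prod.distrib inner_vec_def exp_sum mult.commute prod_nonneg)
  then have "(\<integral>\<^sup>+x. ennreal (\<Prod>j\<in>UNIV. normal_density 0 (sqrt s) (x $ j)) * ennreal (exp (k \<bullet> x)) \<partial>lborel)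
      = (\<Prod>j\<in>UNIV. \<integral>\<^sup>+x. ennreal (exp (k $ j * x) * normal_density 0 (sqrt s) x) \<partial>lborel)"
    by (simp only:) (rule nn_integral_vec_prod, auto)
  also have "\<dots> = ennreal (\<Prod>j\<in>UNIV. exp ((k $ j)\<^sup>2 * s / 2))"
    by (simp only: nn_integral_exp_normal[OF s]) (simp add: prod_ennreal)
  also have "(\<Prod>j\<in>UNIV. exp ((k $ j)\<^sup>2 * s / 2)) = exp ((k \<bullet> k) * s / 2)"
    by (simp add: exp_sum[symmetric] inner_vec_def power2_eq_square sum_distrib_right sum_divide_distrib)
  finally show ?thesis .
qed

section \<open>Brownian motion with drift and its Markov property\<close>

text \<open>The Riemann sum with mesh \<open>h\<close> of the functional along a path that starts at the origin, expressed through the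
  driftless increments \<open>x\<close> of that path; in this form the joint law of independent increments can be applied.\<close>

definition walk_sum :: "('d::finite \<Rightarrow> real ^ 'n) \<Rightarrow> real ^ 'n \<Rightarrow> real \<Rightarrow> nat \<Rightarrow> (nat \<Rightarrow> real ^ 'n) \<Rightarrow> real ^ 'd" where
  "walk_sum \<alpha> \<mu> h L x = h *\<^sub>R (\<Sum>l<L. exp_weights \<alpha> ((\<Sum>j<l. x j) + (real l * h) *\<^sub>R \<mu>))"

lemma walk_sum_cong: "(\<And>j. j < L \<Longrightarrow> x j = y j) \<Longrightarrow> walk_sum \<alpha> \<mu> h L x = walk_sum \<alpha> \<mu> h L y"
  unfolding walk_sum_def by (intro arg_cong2[where f = scaleR] refl sum.cong arg_cong2[where f = exp_weights] arg_cong2[where f = plus]) auto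

lemma vec_times_scaleR: "c * (r *\<^sub>R s) = r *\<^sub>R (c * s)" for c s :: "real ^ 'd"
  by (simp add: vec_eq_iff)

lemma sum_lessThan_add: "(\<Sum>l<K + L. f l) = (\<Sum>l<K. f l) + (\<Sum>l<L. f (K + l))"
  for f :: "nat \<Rightarrow> 'z::comm_monoid_add"
  by (induction L) (simp_all add: add.assoc)

text \<open>The flow property \<open>A = A\<^sub>t + c(B\<^sub>t) A'\<close> at the level of Riemann sums.\<close>

lemma walk_sum_add:
  "walk_sum \<alpha> \<mu> h (K + L) x =
    walk_sum \<alpha> \<mu> h K x + exp_weights \<alpha> ((\<Sum>j<K. x j) + (real K * h) *\<^sub>R \<mu>) * walk_sum \<alpha> \<mu> h L (\<lambda>j. x (K + j))"
  unfolding walk_sum_def sum_lessThan_add vec_times_scaleR scaleR_add_right sum_distrib_left exp_weights_add[symmetric]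
  by (simp add: add_ac distrib_right scaleR_add_left)

lemma measurable_walk_sum [measurable]:
  "walk_sum \<alpha> \<mu> h L \<in> borel_measurable (PiM {..<L} (\<lambda>_. borel))"
  unfolding walk_sum_def
  by (intro borel_measurable_scaleR borel_measurable_const borel_measurable_sum borel_measurable_exp_weights borel_measurable_add
      measurable_component_singleton) auto

lemma A_infty_nonneg: "0 \<le> A_infty \<alpha> B \<omega> $ i"
  by (simp add: A_infty_def set_lebesgue_integral_def)

text \<open>The driftless process \<open>W\<close> and the process \<open>B\<close> are both kept as parameters because \<open>B\<close> is constrained only at
  nonnegative times and on the sample space.\<close>

locale drifted_bm =
  fixes M :: "'w measure" and \<alpha> :: "'d::finite \<Rightarrow> real ^ 'n" and \<mu> :: "real ^ 'n"
    and W B :: "real \<Rightarrow> 'w \<Rightarrow> real ^ 'n"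
  assumes sbm: "standard_brownian_motion M W"
    and B_eq: "\<And>t \<omega>. 0 \<le> t \<Longrightarrow> \<omega> \<in> space M \<Longrightarrow> B t \<omega> = W t \<omega> + t *\<^sub>R \<mu>"
begin

sublocale prob_space M using sbm by (simp add: standard_brownian_motion_def)

lemma W_meas: "0 \<le> t \<Longrightarrow> W t \<in> borel_measurable M"
  and W_0: "\<omega> \<in> space M \<Longrightarrow> W 0 \<omega> = 0"
  and W_cont: "\<omega> \<in> space M \<Longrightarrow> continuous_on {0..} (\<lambda>t. W t \<omega>)"
  and W_indep: "0 \<le> u 0 \<Longrightarrow> mono u \<Longrightarrow>
        indep_vars (\<lambda>_. borel) (\<lambda>k \<omega>. W (u (Suc k)) \<omega> - W (u k) \<omega>) {..<m}"
  and W_distr: "0 \<le> s \<Longrightarrow> s < t \<Longrightarrow> distributed M lborel (\<lambda>\<omega>. W t \<omega> - W s \<omega>)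
          (\<lambda>x. ennreal (\<Prod>j\<in>UNIV. normal_density 0 (sqrt (t - s)) (x $ j)))"
  using sbm unfolding standard_brownian_motion_def by blast+

lemma B_0: "\<omega> \<in> space M \<Longrightarrow> B 0 \<omega> = 0"
  by (simp add: B_eq W_0)

lemma B_meas: "0 \<le> t \<Longrightarrow> B t \<in> borel_measurable M"
  using W_meas[of t] by (subst measurable_cong[OF B_eq]) auto

lemma B_cont: "\<omega> \<in> space M \<Longrightarrow> continuous_on {0..} (\<lambda>t. B t \<omega>)"
  by (subst continuous_on_cong[OF refl B_eq]) (auto intro!: continuous_intros W_cont)

definition W_incr :: "real \<Rightarrow> nat \<Rightarrow> 'w \<Rightarrow> real ^ 'n" where
  "W_incr h k \<omega> = W (real (Suc k) * h) \<omega> - W (real k * h) \<omega>"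

definition riemann_A :: "real \<Rightarrow> nat \<Rightarrow> 'w \<Rightarrow> real ^ 'd" where
  "riemann_A h L \<omega> = h *\<^sub>R (\<Sum>l<L. exp_weights \<alpha> (B (real l * h) \<omega>))"

lemma sum_W_incr: "0 \<le> h \<Longrightarrow> \<omega> \<in> space M \<Longrightarrow> (\<Sum>j<l. W_incr h j \<omega>) = W (real l * h) \<omega>"
  by (induction l) (simp_all add: W_incr_def W_0)

lemma riemann_A_eq: "0 \<le> h \<Longrightarrow> \<omega> \<in> space M \<Longrightarrow> riemann_A h L \<omega> = walk_sum \<alpha> \<mu> h L (\<lambda>j. W_incr h j \<omega>)"
  by (simp add: riemann_A_def walk_sum_def sum_W_incr B_eq)

lemma W_incr_meas: "0 \<le> h \<Longrightarrow> W_incr h k \<in> borel_measurable M"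
  unfolding W_incr_def by (intro borel_measurable_diff W_meas) auto

lemma W_incr_distr:
  assumes "0 < h"
  shows "distr M borel (W_incr h k) = distr M borel (W_incr h 0)"
proof -
  have "distr M borel (W_incr h k) = density lborel (\<lambda>x. ennreal (\<Prod>j\<in>UNIV. normal_density 0 (sqrt h) (x $ j)))" for k
  proof -
    have "real (Suc k) * h - real k * h = h" by (simp add: algebra_simps)
    then have "distributed M lborel (W_incr h k) (\<lambda>x. ennreal (\<Prod>j\<in>UNIV. normal_density 0 (sqrt h) (x $ j)))"
      unfolding W_incr_def[abs_def] using W_distr[of "real k * h" "real (Suc k) * h"] assms by auto
    then have "distr M lborel (W_incr h k) = density lborel (\<lambda>x. ennreal (\<Prod>j\<in>UNIV. normal_density 0 (sqrt h) (x $ j)))"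
      by (rule distributed_distr_eq_density)
    then show ?thesis by (simp cong: distr_cong)
  qed
  then show ?thesis by simp
qed

lemma W_incr_indep:
  assumes "0 \<le> h"
  shows "indep_vars (\<lambda>_. borel) (\<lambda>j. W_incr h (K + j)) {..<L}"
proof -
  have "mono (\<lambda>k. real (K + k) * h)" using assms by (auto intro!: monoI mult_right_mono)
  from W_indep[OF _ this, of L] show ?thesis using assms by (simp add: W_incr_def[abs_def] add_ac)
qed

lemma W_incr_block_distr:
  assumes h: "0 < h" and L: "0 < L"
  shows "distr M (PiM {..<L} (\<lambda>_. borel)) (\<lambda>\<omega>. \<lambda>j\<in>{..<L}. W_incr h (K + j) \<omega>)
    = distr M (PiM {..<L} (\<lambda>_. borel)) (\<lambda>\<omega>. \<lambda>j\<in>{..<L}. W_incr h j \<omega>)"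
proof -
  have *: "distr M (PiM {..<L} (\<lambda>_. borel)) (\<lambda>\<omega>. \<lambda>j\<in>{..<L}. W_incr h (K + j) \<omega>)
      = PiM {..<L} (\<lambda>j. distr M borel (W_incr h (K + j)))" for K
    using indep_vars_iff_distr_eq_PiM'[where I = "{..<L}" and M' = "\<lambda>_. borel" and X = "\<lambda>j. W_incr h (K + j)"] L h W_incr_indep[of h K L]
    by (auto simp: W_incr_meas less_imp_le lessThan_empty_iff)
  have "distr M borel (W_incr h (K + j)) = distr M borel (W_incr h (0 + j))" for j
    by (metis W_incr_distr[OF h])
  then show ?thesis using *[of K] *[of 0] by simp
qed

text \<open>Riemann sums involve finitely many increments: those before and those after time \<open>K h\<close> are independent, and the
  later block has the law of the initial one. So the later part may be replaced by the initial part of an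
  independent path \<open>\<omega>'\<close>, which is integrated separately.\<close>

lemma markov_discrete:
  fixes V :: "real ^ 'd \<Rightarrow> real"
  assumes h: "0 < h" and K: "0 < K" and L: "0 < L"
    and V [measurable]: "V \<in> borel_measurable borel" and bdd: "\<And>y. \<bar>V y\<bar> \<le> C"
  shows "(\<integral>\<omega>. V (a + c * riemann_A h (K + L) \<omega>) \<partial>M) =
    (\<integral>\<omega>. \<integral>\<omega>'. V (a + c * riemann_A h K \<omega> + c * (exp_weights \<alpha> (B (real K * h) \<omega>) * riemann_A h L \<omega>')) \<partial>M \<partial>M)"
proof -
  let ?PK = "PiM {..<K} (\<lambda>_. borel) :: (nat \<Rightarrow> real ^ 'n) measure"
  let ?PL = "PiM {..<L} (\<lambda>_. borel) :: (nat \<Rightarrow> real ^ 'n) measure"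
  let ?PB = "PiM {K..<K + L} (\<lambda>_. borel) :: (nat \<Rightarrow> real ^ 'n) measure"
  \<comment> \<open>\<open>X\<close> is the block before time \<open>K h\<close>, \<open>Y\<close> the block after it, and \<open>Z\<close> the initial block with the law of \<open>Y\<close>.\<close>
  define X where "X \<omega> = (\<lambda>j\<in>{..<K}. W_incr h j \<omega>)" for \<omega>
  define Y where "Y \<omega> = (\<lambda>j\<in>{..<L}. W_incr h (K + j) \<omega>)" for \<omega>
  define Z where "Z \<omega> = (\<lambda>j\<in>{..<L}. W_incr h j \<omega>)" for \<omega>
  define G where "G x = exp_weights \<alpha> ((\<Sum>j<K. x j) + (real K * h) *\<^sub>R \<mu>)" for x :: "nat \<Rightarrow> real ^ 'n"
  define F where "F x y = V (a + c * walk_sum \<alpha> \<mu> h K x + c * (G x * walk_sum \<alpha> \<mu> h L y))" for x y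
  have [measurable]: "G \<in> borel_measurable ?PK"
    unfolding G_def by (intro borel_measurable_exp_weights borel_measurable_add borel_measurable_sum measurable_component_singleton) auto
  have Fm [measurable]: "(\<lambda>p. F (fst p) (snd p)) \<in> borel_measurable (?PK \<Otimes>\<^sub>M ?PL)"
    unfolding F_def by measurable
  have [measurable]: "X \<in> measurable M ?PK" "Y \<in> measurable M ?PL" "Z \<in> measurable M ?PL"
    unfolding X_def Y_def Z_def using h by (auto intro!: measurable_restrict W_incr_meas)
  have "indep_var ?PK X ?PL Y"
  proof -
    have 1: "indep_vars (\<lambda>_. borel) (W_incr h) {..<K + L}" using W_incr_indep[of h 0 "K + L"] h by simp
    have 2: "indep_var ?PK X ?PB (\<lambda>\<omega>. \<lambda>j\<in>{K..<K + L}. W_incr h j \<omega>)"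
      unfolding X_def[abs_def] by (rule indep_var_restrict[OF 1]) auto
    have "indep_var ?PK (id \<circ> X) ?PL ((\<lambda>f. \<lambda>j\<in>{..<L}. f (K + j)) \<circ> (\<lambda>\<omega>. \<lambda>j\<in>{K..<K + L}. W_incr h j \<omega>))"
      by (rule indep_var_compose[OF 2]) (auto intro!: measurable_restrict measurable_component_singleton)
    also have "id \<circ> X = X" by simp
    also have "(\<lambda>f. \<lambda>j\<in>{..<L}. f (K + j)) \<circ> (\<lambda>\<omega>. \<lambda>j\<in>{K..<K + L}. W_incr h j \<omega>) = Y"
      by (auto simp: Y_def fun_eq_iff restrict_def)
    finally show ?thesis .
  qed
  then have prod: "distr M ?PK X \<Otimes>\<^sub>M distr M ?PL Y = distr M (?PK \<Otimes>\<^sub>M ?PL) (\<lambda>\<omega>. (X \<omega>, Y \<omega>))"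
    by (simp add: indep_var_distribution_eq)
  have YZ: "distr M ?PL Y = distr M ?PL Z"
    unfolding Y_def[abs_def] Z_def[abs_def] by (rule W_incr_block_distr[OF h L])
  interpret PX: prob_space "distr M ?PK X" by (rule prob_space_distr) measurable
  interpret PY: prob_space "distr M ?PL Y" by (rule prob_space_distr) measurable
  interpret PP: pair_prob_space "distr M ?PK X" "distr M ?PL Y" ..
  have int: "integrable (distr M ?PK X \<Otimes>\<^sub>M distr M ?PL Y) (\<lambda>p. F (fst p) (snd p))"
    by (rule PP.integrable_const_bound[of _ C]) (auto simp: F_def bdd cong: measurable_cong_sets)
  have "V (a + c * riemann_A h (K + L) \<omega>) = F (X \<omega>) (Y \<omega>)" if "\<omega> \<in> space M" for \<omega>
  proof -
    have "walk_sum \<alpha> \<mu> h K (\<lambda>j. W_incr h j \<omega>) = walk_sum \<alpha> \<mu> h K (X \<omega>)"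
      "walk_sum \<alpha> \<mu> h L (\<lambda>j. W_incr h (K + j) \<omega>) = walk_sum \<alpha> \<mu> h L (Y \<omega>)"
      by (auto intro!: walk_sum_cong simp: X_def Y_def)
    moreover have "exp_weights \<alpha> ((\<Sum>j<K. W_incr h j \<omega>) + (real K * h) *\<^sub>R \<mu>) = G (X \<omega>)"
      by (simp add: G_def X_def)
    ultimately show ?thesis
      using that h by (simp add: F_def riemann_A_eq walk_sum_add distrib_left add.assoc)
  qed
  then have "(\<integral>\<omega>. V (a + c * riemann_A h (K + L) \<omega>) \<partial>M) = (\<integral>\<omega>. F (X \<omega>) (Y \<omega>) \<partial>M)"
    by (intro Bochner_Integration.integral_cong) auto
  also have "\<dots> = (\<integral>p. F (fst p) (snd p) \<partial>distr M (?PK \<Otimes>\<^sub>M ?PL) (\<lambda>\<omega>. (X \<omega>, Y \<omega>)))"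
    by (subst integral_distr) auto
  also have "\<dots> = (\<integral>p. F (fst p) (snd p) \<partial>(distr M ?PK X \<Otimes>\<^sub>M distr M ?PL Y))"
    by (simp only: prod)
  also have "\<dots> = (\<integral>x. \<integral>y. F x y \<partial>distr M ?PL Y \<partial>distr M ?PK X)"
    using PP.integral_fst'[OF int] by simp
  also have "\<dots> = (\<integral>x. \<integral>\<omega>'. F x (Z \<omega>') \<partial>M \<partial>distr M ?PK X)"
  proof (rule Bochner_Integration.integral_cong[OF refl])
    fix x assume "x \<in> space (distr M ?PK X)"
    then have x: "x \<in> space ?PK" by simp
    have "F x \<in> borel_measurable ?PL" 
      using measurable_compose[OF measurable_Pair1'[OF x] Fm] by simp
    then show "(\<integral>y. F x y \<partial>distr M ?PL Y) = (\<integral>\<omega>'. F x (Z \<omega>') \<partial>M)"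
      unfolding YZ by (subst integral_distr) auto
  qed
  also have "\<dots> = (\<integral>\<omega>. \<integral>\<omega>'. F (X \<omega>) (Z \<omega>') \<partial>M \<partial>M)"
    by (subst integral_distr) (auto simp: F_def)
  also have "\<dots> = (\<integral>\<omega>. \<integral>\<omega>'. V (a + c * riemann_A h K \<omega> + c * (exp_weights \<alpha> (B (real K * h) \<omega>) * riemann_A h L \<omega>')) \<partial>M \<partial>M)"
  proof (intro Bochner_Integration.integral_cong refl)
    fix \<omega> \<omega>' assume w: "\<omega> \<in> space M" "\<omega>' \<in> space M"
    have 1: "walk_sum \<alpha> \<mu> h K (\<lambda>j. W_incr h j \<omega>) = walk_sum \<alpha> \<mu> h K (X \<omega>)"
      "walk_sum \<alpha> \<mu> h L (\<lambda>j. W_incr h j \<omega>') = walk_sum \<alpha> \<mu> h L (Z \<omega>')"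
      by (auto intro!: walk_sum_cong simp: X_def Z_def)
    have 2: "exp_weights \<alpha> (B (real K * h) \<omega>) = G (X \<omega>)"
      using w h sum_W_incr[of h \<omega> K] by (simp add: G_def X_def B_eq)
    show "F (X \<omega>) (Z \<omega>') = V (a + c * riemann_A h K \<omega> + c * (exp_weights \<alpha> (B (real K * h) \<omega>) * riemann_A h L \<omega>'))"
      using w h by (simp add: F_def riemann_A_eq 1 2)
  qed
  finally show ?thesis .
qed

definition A_upto :: "real \<Rightarrow> 'w \<Rightarrow> real ^ 'd" where
  "A_upto t \<omega> = (\<chi> i. integral {0..t} (\<lambda>s. exp (-2 * (\<alpha> i \<bullet> B s \<omega>))))"

lemma riemann_A_tendsto:
  assumes t: "0 < t" and m: "0 < m" and w: "\<omega> \<in> space M"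
  shows "(\<lambda>N. riemann_A (t / real N) (m * N) \<omega>) \<longlonglongrightarrow> A_upto (real m * t) \<omega>"
proof (rule vec_tendstoI)
  fix i
  have "continuous_on {0..} (\<lambda>s. exp (-2 * (\<alpha> i \<bullet> B s \<omega>)))"
    by (intro continuous_intros B_cont[OF w])
  from riemann_sum_tendsto_mult[OF t this m]
  show "(\<lambda>N. riemann_A (t / real N) (m * N) \<omega> $ i) \<longlonglongrightarrow> A_upto (real m * t) \<omega> $ i"
    by (simp add: riemann_A_def A_upto_def)
qed

lemma riemann_A_meas [measurable]: "0 \<le> h \<Longrightarrow> riemann_A h L \<in> borel_measurable M"
  unfolding riemann_A_def
  by (intro borel_measurable_scaleR borel_measurable_const borel_measurable_sum borel_measurable_exp_weights B_meas) auto

lemma A_upto_meas: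
  assumes t: "0 < t"
  shows "A_upto t \<in> borel_measurable M"
proof (rule borel_measurable_LIMSEQ_metric)
  show "riemann_A (t / real N) (1 * N) \<in> borel_measurable M" for N using t by (intro riemann_A_meas) simp
  show "(\<lambda>N. riemann_A (t / real N) (1 * N) \<omega>) \<longlonglongrightarrow> A_upto t \<omega>" if "\<omega> \<in> space M" for \<omega>
    using riemann_A_tendsto[OF t _ that, of 1] by simp
qed

text \<open>The inner limit is taken almost surely because the perpetual functional is finite only almost surely.\<close>

lemma double_integral_tendsto:
  fixes f :: "nat \<Rightarrow> 'w \<Rightarrow> 'w \<Rightarrow> real"
  assumes f [measurable]: "\<And>n. (\<lambda>p. f n (fst p) (snd p)) \<in> borel_measurable (M \<Otimes>\<^sub>M M)"
    and g [measurable]: "(\<lambda>p. g (fst p) (snd p)) \<in> borel_measurable (M \<Otimes>\<^sub>M M)"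
    and bdd: "\<And>n x y. \<bar>f n x y\<bar> \<le> C"
    and lim: "\<And>x. x \<in> space M \<Longrightarrow> AE y in M. (\<lambda>n. f n x y) \<longlonglongrightarrow> g x y"
  shows "(\<lambda>n. \<integral>x. \<integral>y. f n x y \<partial>M \<partial>M) \<longlonglongrightarrow> (\<integral>x. \<integral>y. g x y \<partial>M \<partial>M)"
proof (rule integral_dominated_convergence[where w = "\<lambda>_. C"])
  have fm: "f n x \<in> borel_measurable M" if "x \<in> space M" for n x
    using measurable_compose[OF measurable_Pair1'[OF that] f[of n]] by simp
  have gm: "g x \<in> borel_measurable M" if "x \<in> space M" for x
    using measurable_compose[OF measurable_Pair1'[OF that] g] by simp
  show "(\<lambda>x. \<integral>y. g x y \<partial>M) \<in> borel_measurable M" 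
    using borel_measurable_lebesgue_integral[of "\<lambda>x y. g x y" M] g by (simp add: case_prod_unfold)
  show "(\<lambda>x. \<integral>y. f n x y \<partial>M) \<in> borel_measurable M" for n
    using borel_measurable_lebesgue_integral[of "\<lambda>x y. f n x y" M] f[of n] by (simp add: case_prod_unfold)
  show "AE x in M. (\<lambda>n. \<integral>y. f n x y \<partial>M) \<longlonglongrightarrow> (\<integral>y. g x y \<partial>M)"
  proof (rule AE_I2)
    fix x assume x: "x \<in> space M"
    show "(\<lambda>n. \<integral>y. f n x y \<partial>M) \<longlonglongrightarrow> (\<integral>y. g x y \<partial>M)"
      by (rule integral_dominated_convergence[where w = "\<lambda>_. C"]) (simp_all add: fm[OF x] gm[OF x] lim[OF x] bdd)
  qed
  show "AE x in M. norm (\<integral>y. f n x y \<partial>M) \<le> C" for n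
  proof (rule AE_I2)
    fix x assume x: "x \<in> space M"
    have "norm (\<integral>y. f n x y \<partial>M) \<le> (\<integral>y. norm (f n x y) \<partial>M)" by (rule integral_norm_bound)
    also have "\<dots> \<le> (\<integral>y. C \<partial>M)"
      by (rule Bochner_Integration.integral_mono)
         (auto intro!: integrable_const_bound[of _ C] borel_measurable_abs fm[OF x] simp: bdd)
    finally show "norm (\<integral>y. f n x y \<partial>M) \<le> C" using prob_space by simp
  qed
qed simp

lemma markov_finite:
  fixes V :: "real ^ 'd \<Rightarrow> real"
  assumes t: "0 < t" and m: "0 < m" and V: "continuous_on UNIV V" and bdd: "\<And>y. \<bar>V y\<bar> \<le> C"
  shows "(\<integral>\<omega>. V (a + c * A_upto (real (Suc m) * t) \<omega>) \<partial>M) =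
    (\<integral>\<omega>. \<integral>\<omega>'. V (a + c * A_upto t \<omega> + c * (exp_weights \<alpha> (B t \<omega>) * A_upto (real m * t) \<omega>')) \<partial>M \<partial>M)"
proof -
  have Vm [measurable]: "V \<in> borel_measurable borel" by (rule borel_measurable_continuous_onI[OF V])
  have Vlim: "((\<lambda>x. V (f x)) \<longlongrightarrow> V l) F" if "(f \<longlongrightarrow> l) F" for f l and F :: "nat filter"
    using continuous_on_tendsto_compose[OF V that] by simp
  have [measurable]: "B t \<in> borel_measurable M" "A_upto t \<in> borel_measurable M" "A_upto (real m * t) \<in> borel_measurable M"
    "A_upto (real (Suc m) * t) \<in> borel_measurable M"
    using t m by (auto intro: B_meas A_upto_meas simp del: of_nat_Suc)
  have Sm [measurable]: "riemann_A (t / real N) L \<in> borel_measurable M" for N L using t by (intro riemann_A_meas) simp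
  have 1: "(\<lambda>N. \<integral>\<omega>. V (a + c * riemann_A (t / real N) (Suc m * N) \<omega>) \<partial>M) \<longlonglongrightarrow> (\<integral>\<omega>. V (a + c * A_upto (real (Suc m) * t) \<omega>) \<partial>M)"
    by (rule integral_dominated_convergence[where w = "\<lambda>_. C"])
       (auto simp: bdd simp del: of_nat_Suc mult_Suc intro!: Vlim tendsto_intros riemann_A_tendsto t)
  have 2: "(\<lambda>N. \<integral>\<omega>. \<integral>\<omega>'. V (a + c * riemann_A (t / real N) (1 * N) \<omega> + c * (exp_weights \<alpha> (B t \<omega>) * riemann_A (t / real N) (m * N) \<omega>')) \<partial>M \<partial>M)
     \<longlonglongrightarrow> (\<integral>\<omega>. \<integral>\<omega>'. V (a + c * A_upto (real 1 * t) \<omega> + c * (exp_weights \<alpha> (B t \<omega>) * A_upto (real m * t) \<omega>')) \<partial>M \<partial>M)"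
    by (rule double_integral_tendsto[where C = C])
       (use t m riemann_A_tendsto[OF t zero_less_one] in \<open>auto simp: bdd simp del: of_nat_1 mult_1 intro!: Vlim tendsto_intros riemann_A_tendsto AE_I2\<close>)
  have "eventually (\<lambda>N. (\<integral>\<omega>. V (a + c * riemann_A (t / real N) (Suc m * N) \<omega>) \<partial>M) =
      (\<integral>\<omega>. \<integral>\<omega>'. V (a + c * riemann_A (t / real N) (1 * N) \<omega> + c * (exp_weights \<alpha> (B t \<omega>) * riemann_A (t / real N) (m * N) \<omega>')) \<partial>M \<partial>M)) sequentially"
    using eventually_gt_at_top[of 0]
  proof eventually_elim
    case (elim N)
    then show ?case
      using markov_discrete[of "t / real N" N "m * N" V C a c] t m bdd by simp
  qed
  with 1 have "(\<lambda>N. \<integral>\<omega>. \<integral>\<omega>'. V (a + c * riemann_A (t / real N) (1 * N) \<omega> + c * (exp_weights \<alpha> (B t \<omega>) * riemann_A (t / real N) (m * N) \<omega>')) \<partial>M \<partial>M)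
      \<longlonglongrightarrow> (\<integral>\<omega>. V (a + c * A_upto (real (Suc m) * t) \<omega>) \<partial>M)"
    by (rule Lim_transform_eventually)
  from LIMSEQ_unique[OF this 2] show ?thesis by simp
qed

text \<open>If a component integral diverged, the Bochner integral would be \<open>0\<close>; hence membership of the open orthant certifies
  that all of them converge.\<close>

lemma A_upto_tendsto_A_infty:
  assumes w: "\<omega> \<in> space M" and o: "A_infty \<alpha> B \<omega> \<in> orthant" and t: "0 < t"
  shows "(\<lambda>m. A_upto (real m * t) \<omega>) \<longlonglongrightarrow> A_infty \<alpha> B \<omega>"
proof (rule vec_tendstoI)
  fix i
  let ?f = "\<lambda>s. exp (-2 * (\<alpha> i \<bullet> B s \<omega>))"
  have c: "continuous_on {0..} ?f" by (intro continuous_intros B_cont[OF w])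
  have pos: "0 < (LINT s:{0..}|lborel. ?f s)" using o by (simp add: orthant_def A_infty_def)
  have int: "set_integrable lborel {0..} ?f"
  proof (rule ccontr)
    assume "\<not> set_integrable lborel {0..} ?f"
    then have "(LINT s:{0..}|lborel. ?f s) = 0"
      unfolding set_integrable_def set_lebesgue_integral_def by (rule not_integrable_integral_eq)
    with pos show False by simp
  qed
  have "((\<lambda>b. LINT s:{0..b}|lborel. ?f s) \<longlongrightarrow> (LINT s:{0..}|lborel. ?f s)) at_top"
    by (rule tendsto_set_lebesgue_integral_at_top[OF _ int]) simp
  moreover have "filterlim (\<lambda>m. real m * t) at_top sequentially"
    using t by (intro filterlim_at_top_mult_tendsto_pos[OF tendsto_const] filterlim_real_sequentially)
  ultimately have "(\<lambda>m. LINT s:{0..real m * t}|lborel. ?f s) \<longlonglongrightarrow> (LINT s:{0..}|lborel. ?f s)"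
    by (rule filterlim_compose)
  moreover have "(LINT s:{0..b}|lborel. ?f s) = integral {0..b} ?f" for b
    by (rule set_borel_integral_eq_integral)
       (rule set_integrable_subset[OF int], auto)
  ultimately show "(\<lambda>m. A_upto (real m * t) \<omega> $ i) \<longlonglongrightarrow> A_infty \<alpha> B \<omega> $ i"
    by (simp add: A_upto_def A_infty_def)
qed

lemma markov_A_infty:
  fixes V :: "real ^ 'd \<Rightarrow> real"
  assumes t: "0 < t" and V: "continuous_on UNIV V" and bdd: "\<And>y. \<bar>V y\<bar> \<le> C"
    and Am [measurable]: "A_infty \<alpha> B \<in> borel_measurable M"
    and o: "AE \<omega> in M. A_infty \<alpha> B \<omega> \<in> orthant"
  shows "(\<integral>\<omega>. V (a + c * A_infty \<alpha> B \<omega>) \<partial>M) =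
    (\<integral>\<omega>. \<integral>\<omega>'. V (a + c * A_upto t \<omega> + c * (exp_weights \<alpha> (B t \<omega>) * A_infty \<alpha> B \<omega>')) \<partial>M \<partial>M)"
proof -
  have Vm [measurable]: "V \<in> borel_measurable borel" by (rule borel_measurable_continuous_onI[OF V])
  have Vlim: "((\<lambda>x. V (f x)) \<longlongrightarrow> V l) F" if "(f \<longlongrightarrow> l) F" for f l and F :: "nat filter"
    using continuous_on_tendsto_compose[OF V that] by simp
  have Bm [measurable]: "B t \<in> borel_measurable M" "A_upto t \<in> borel_measurable M" 
    using t by (auto intro: B_meas A_upto_meas)
  have Sm [measurable]: "A_upto (real (Suc m) * t) \<in> borel_measurable M" for m
    using t by (intro A_upto_meas) simp
  have lim: "AE \<omega> in M. (\<lambda>m. A_upto (real (Suc m) * t) \<omega>) \<longlonglongrightarrow> A_infty \<alpha> B \<omega>"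
    using o AE_space by eventually_elim (rule LIMSEQ_Suc[OF A_upto_tendsto_A_infty[OF _ _ t]])
  have 1: "(\<lambda>m. \<integral>\<omega>. V (a + c * A_upto (real (Suc m) * t) \<omega>) \<partial>M) \<longlonglongrightarrow> (\<integral>\<omega>. V (a + c * A_infty \<alpha> B \<omega>) \<partial>M)"
  proof (rule integral_dominated_convergence[where w = "\<lambda>_. C"])
    show "AE \<omega> in M. (\<lambda>m. V (a + c * A_upto (real (Suc m) * t) \<omega>)) \<longlonglongrightarrow> V (a + c * A_infty \<alpha> B \<omega>)"
      using lim by eventually_elim (intro Vlim tendsto_intros)
  qed (auto simp: bdd simp del: of_nat_Suc)
  have 2: "(\<lambda>m. \<integral>\<omega>. \<integral>\<omega>'. V (a + c * A_upto t \<omega> + c * (exp_weights \<alpha> (B t \<omega>) * A_upto (real (Suc m) * t) \<omega>')) \<partial>M \<partial>M)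
     \<longlonglongrightarrow> (\<integral>\<omega>. \<integral>\<omega>'. V (a + c * A_upto t \<omega> + c * (exp_weights \<alpha> (B t \<omega>) * A_infty \<alpha> B \<omega>')) \<partial>M \<partial>M)"
  proof (rule double_integral_tendsto[where C = C])
    show "AE \<omega>' in M. (\<lambda>m. V (a + c * A_upto t \<omega> + c * (exp_weights \<alpha> (B t \<omega>) * A_upto (real (Suc m) * t) \<omega>')))
      \<longlonglongrightarrow> V (a + c * A_upto t \<omega> + c * (exp_weights \<alpha> (B t \<omega>) * A_infty \<alpha> B \<omega>'))" for \<omega>
      using lim by eventually_elim (intro Vlim tendsto_intros)
  qed (auto simp: bdd simp del: of_nat_Suc)
  have "(\<lambda>m. \<integral>\<omega>. V (a + c * A_upto (real (Suc (Suc m)) * t) \<omega>) \<partial>M) \<longlonglongrightarrow> (\<integral>\<omega>. V (a + c * A_infty \<alpha> B \<omega>) \<partial>M)"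
    using LIMSEQ_Suc[OF 1] .
  moreover have "(\<integral>\<omega>. V (a + c * A_upto (real (Suc (Suc m)) * t) \<omega>) \<partial>M)
    = (\<integral>\<omega>. \<integral>\<omega>'. V (a + c * A_upto t \<omega> + c * (exp_weights \<alpha> (B t \<omega>) * A_upto (real (Suc m) * t) \<omega>')) \<partial>M \<partial>M)" for m
    by (rule markov_finite[OF t _ V bdd]) simp
  ultimately show ?thesis using LIMSEQ_unique[OF _ 2] by simp
qed

end

section \<open>The functional over short times\<close>

context drifted_bm
begin

lemma nn_integral_exp_W:
  assumes "0 < s"
  shows "(\<integral>\<^sup>+\<omega>. ennreal (exp (k \<bullet> W s \<omega>)) \<partial>M) = ennreal (exp ((k \<bullet> k) * s / 2))"
proof -
  have "distributed M lborel (\<lambda>\<omega>. W s \<omega> - W 0 \<omega>) (\<lambda>x. ennreal (\<Prod>j\<in>UNIV. normal_density 0 (sqrt s) (x $ j)))"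
    using W_distr[of 0 s] assms by simp
  then have "(\<integral>\<^sup>+\<omega>. ennreal (exp (k \<bullet> (W s \<omega> - W 0 \<omega>))) \<partial>M) = ennreal (exp ((k \<bullet> k) * s / 2))"
    by (subst distributed_nn_integral[symmetric]) (auto simp: nn_integral_exp_normal_vec[OF assms])
  then show ?thesis by (simp add: W_0 cong: nn_integral_cong)
qed

lemma exp_B_moment:
  assumes "0 < s"
  shows "integrable M (\<lambda>\<omega>. exp (k \<bullet> B s \<omega>))"
    and "(\<integral>\<omega>. exp (k \<bullet> B s \<omega>) \<partial>M) = exp ((k \<bullet> k) * s / 2 + s * (k \<bullet> \<mu>))"
proof -
  have [measurable]: "W s \<in> borel_measurable M" "B s \<in> borel_measurable M"
    using assms by (auto intro: W_meas B_meas)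
  have "(\<integral>\<^sup>+\<omega>. ennreal (exp (k \<bullet> B s \<omega>)) \<partial>M) = (\<integral>\<^sup>+\<omega>. ennreal (exp (s * (k \<bullet> \<mu>))) * ennreal (exp (k \<bullet> W s \<omega>)) \<partial>M)"
    using assms
    by (intro nn_integral_cong) (simp add: B_eq inner_add_right exp_add ennreal_mult[symmetric] mult.commute)
  also have "\<dots> = ennreal (exp (s * (k \<bullet> \<mu>))) * ennreal (exp ((k \<bullet> k) * s / 2))"
    by (simp add: nn_integral_cmult nn_integral_exp_W[OF assms])
  also have "\<dots> = ennreal (exp ((k \<bullet> k) * s / 2 + s * (k \<bullet> \<mu>)))"
    by (simp add: ennreal_mult[symmetric] exp_add mult.commute)
  finally have nn: "(\<integral>\<^sup>+\<omega>. ennreal (exp (k \<bullet> B s \<omega>)) \<partial>M) = ennreal (exp ((k \<bullet> k) * s / 2 + s * (k \<bullet> \<mu>)))" .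
  show "integrable M (\<lambda>\<omega>. exp (k \<bullet> B s \<omega>))"
    by (rule integrableI_nonneg) (auto simp: nn)
  show "(\<integral>\<omega>. exp (k \<bullet> B s \<omega>) \<partial>M) = exp ((k \<bullet> k) * s / 2 + s * (k \<bullet> \<mu>))"
    by (rule integral_eq_nn_integral[THEN trans]) (auto simp: nn)
qed

text \<open>Here \<open>q\<close> is the second moment of \<open>e\<^sup>k\<^sup>\<cdot>\<^sup>B - 1\<close>, and the bound is \<open>\<bar>y\<bar> \<le> e/2 + y\<^sup>2/(2e)\<close> in expectation. For small \<open>s\<close> the
  moment \<open>q\<close> falls below \<open>e\<^sup>2\<close>, and the right-hand side below \<open>e\<close>.\<close>

lemma exp_B_dist_1:
  fixes k :: "real ^ 'n"
  assumes s: "0 < s" and e: "0 < e"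
  defines "q \<equiv> exp (2 * (k \<bullet> k) * s + 2 * s * (k \<bullet> \<mu>)) - 2 * exp ((k \<bullet> k) * s / 2 + s * (k \<bullet> \<mu>)) + 1"
  shows "(\<integral>\<^sup>+\<omega>. ennreal \<bar>exp (k \<bullet> B s \<omega>) - 1\<bar> \<partial>M) \<le> ennreal (e / 2 + q / (2 * e))"
proof -
  have [measurable]: "B s \<in> borel_measurable M" using s by (auto intro: B_meas)
  have sq: "(exp (k \<bullet> B s \<omega>) - 1)\<^sup>2 = exp ((2 *\<^sub>R k) \<bullet> B s \<omega>) - 2 * exp (k \<bullet> B s \<omega>) + 1" for \<omega>
    by (simp add: power2_eq_square algebra_simps exp_add[symmetric])
  note int = exp_B_moment(1)[OF s, of "2 *\<^sub>R k"] exp_B_moment(1)[OF s, of k]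
  have i2: "integrable M (\<lambda>\<omega>. (exp (k \<bullet> B s \<omega>) - 1)\<^sup>2)"
    unfolding sq using int by auto
  have E2: "(\<integral>\<omega>. (exp (k \<bullet> B s \<omega>) - 1)\<^sup>2 \<partial>M) = q"
    unfolding sq using int exp_B_moment(2)[OF s, of "2 *\<^sub>R k"] exp_B_moment(2)[OF s, of k]
    by (simp add: q_def prob_space algebra_simps)
  have young: "\<bar>y\<bar> \<le> e / 2 + y\<^sup>2 / (2 * e)" for y
  proof -
    have "0 \<le> (\<bar>y\<bar> - e)\<^sup>2" by simp
    also have "(\<bar>y\<bar> - e)\<^sup>2 = y\<^sup>2 - 2 * e * \<bar>y\<bar> + e\<^sup>2" by (simp add: power2_diff)
    finally have "2 * e * \<bar>y\<bar> \<le> e\<^sup>2 + y\<^sup>2" by linarith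
    then show ?thesis using e by (simp add: field_simps power2_eq_square)
  qed
  have "(\<integral>\<^sup>+\<omega>. ennreal \<bar>exp (k \<bullet> B s \<omega>) - 1\<bar> \<partial>M) \<le> (\<integral>\<^sup>+\<omega>. ennreal (e / 2 + (exp (k \<bullet> B s \<omega>) - 1)\<^sup>2 / (2 * e)) \<partial>M)"
    by (intro nn_integral_mono ennreal_leI young)
  also have "\<dots> = ennreal (\<integral>\<omega>. e / 2 + (exp (k \<bullet> B s \<omega>) - 1)\<^sup>2 / (2 * e) \<partial>M)"
    by (rule nn_integral_eq_integral) (use i2 e in auto)
  also have "(\<integral>\<omega>. e / 2 + (exp (k \<bullet> B s \<omega>) - 1)\<^sup>2 / (2 * e) \<partial>M) = e / 2 + q / (2 * e)"
    using i2 by (simp add: E2 prob_space)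
  finally show ?thesis .
qed

lemma exp_weights_B_near_1:
  assumes e: "0 < e"
  shows "\<exists>t0>0. \<forall>s i. 0 \<le> s \<and> s \<le> t0 \<longrightarrow> (\<integral>\<^sup>+\<omega>. ennreal \<bar>exp_weights \<alpha> (B s \<omega>) $ i - 1\<bar> \<partial>M) \<le> ennreal e"
proof -
  have "\<forall>\<^sub>F s in at_right 0. (\<integral>\<^sup>+\<omega>. ennreal \<bar>exp_weights \<alpha> (B s \<omega>) $ i - 1\<bar> \<partial>M) \<le> ennreal e" for i
  proof -
    define k where "k = -2 *\<^sub>R \<alpha> i"
    define q where "q s = exp (2 * (k \<bullet> k) * s + 2 * s * (k \<bullet> \<mu>)) - 2 * exp ((k \<bullet> k) * s / 2 + s * (k \<bullet> \<mu>)) + 1" for s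
    have "(q \<longlongrightarrow> exp (2 * (k \<bullet> k) * 0 + 2 * 0 * (k \<bullet> \<mu>)) - 2 * exp ((k \<bullet> k) * 0 / 2 + 0 * (k \<bullet> \<mu>)) + 1) (at_right 0)"
      unfolding q_def by (intro tendsto_intros) simp
    then have "(q \<longlongrightarrow> 0) (at_right 0)" by simp
    then have "\<forall>\<^sub>F s in at_right 0. q s < e\<^sup>2" using e by (intro order_tendstoD(2)) auto
    then show ?thesis
      using eventually_at_right_less[of 0]
    proof eventually_elim
      case (elim s)
      have "(\<integral>\<^sup>+\<omega>. ennreal \<bar>exp (k \<bullet> B s \<omega>) - 1\<bar> \<partial>M) \<le> ennreal (e / 2 + q s / (2 * e))"
        unfolding q_def by (rule exp_B_dist_1[OF elim(2) e])
      also have "\<dots> \<le> ennreal e"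
        using elim e by (intro ennreal_leI) (simp add: field_simps power2_eq_square)
      finally show ?case by (simp add: k_def)
    qed
  qed
  then have "\<forall>\<^sub>F s in at_right 0. \<forall>i. (\<integral>\<^sup>+\<omega>. ennreal \<bar>exp_weights \<alpha> (B s \<omega>) $ i - 1\<bar> \<partial>M) \<le> ennreal e"
    by (rule eventually_all_finite)
  then obtain b where b: "0 < b" "\<And>s i. 0 < s \<Longrightarrow> s < b \<Longrightarrow> (\<integral>\<^sup>+\<omega>. ennreal \<bar>exp_weights \<alpha> (B s \<omega>) $ i - 1\<bar> \<partial>M) \<le> ennreal e"
    unfolding eventually_at_right_field by blast
  have "(\<integral>\<^sup>+\<omega>. ennreal \<bar>exp_weights \<alpha> (B 0 \<omega>) $ i - 1\<bar> \<partial>M) = 0" for i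
    by (simp add: B_0 cong: nn_integral_cong)
  then have "(\<integral>\<^sup>+\<omega>. ennreal \<bar>exp_weights \<alpha> (B s \<omega>) $ i - 1\<bar> \<partial>M) \<le> ennreal e" if "0 \<le> s" "s \<le> b / 2" for s i
    using that b(1) b(2)[of s i] by (cases "s = 0") (simp_all only:, auto)
  with b(1) show ?thesis by (intro exI[of _ "b / 2"]) auto
qed

text \<open>The estimate holds for every Riemann sum by the triangle inequality, and passes to the limit by Fatou's lemma.\<close>

lemma A_upto_near:
  assumes e: "0 < e"
  shows "\<exists>t0>0. \<forall>t i. 0 < t \<and> t \<le> t0 \<longrightarrow> (\<integral>\<^sup>+\<omega>. ennreal \<bar>A_upto t \<omega> $ i - t\<bar> \<partial>M) \<le> ennreal (e * t)"
proof -
  obtain t0 where t0: "0 < t0"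
    "\<And>s i. 0 \<le> s \<Longrightarrow> s \<le> t0 \<Longrightarrow> (\<integral>\<^sup>+\<omega>. ennreal \<bar>exp_weights \<alpha> (B s \<omega>) $ i - 1\<bar> \<partial>M) \<le> ennreal e"
    using exp_weights_B_near_1[OF e] by blast
  have "(\<integral>\<^sup>+\<omega>. ennreal \<bar>A_upto t \<omega> $ i - t\<bar> \<partial>M) \<le> ennreal (e * t)" if t: "0 < t" "t \<le> t0" for t i
  proof -
    define f where "f N \<omega> = ennreal \<bar>riemann_A (t / real (Suc N)) (Suc N) \<omega> $ i - t\<bar>" for N \<omega>
    have [measurable]: "f N \<in> borel_measurable M" for N
      unfolding f_def using t by (intro measurable_compose[OF _ measurable_ennreal] borel_measurable_abs
        borel_measurable_diff borel_measurable_vec_nth riemann_A_meas) auto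
    have bound: "(\<integral>\<^sup>+\<omega>. f N \<omega> \<partial>M) \<le> ennreal (e * t)" for N
    proof -
      define h where "h = t / real (Suc N)"
      have h: "0 < h" "real (Suc N) * h = t" using t by (auto simp: h_def)
      have Bm [measurable]: "B (real k * h) \<in> borel_measurable M" for k using h by (intro B_meas) auto
      have "f N \<omega> \<le> (\<Sum>k<Suc N. ennreal h * ennreal \<bar>exp_weights \<alpha> (B (real k * h) \<omega>) $ i - 1\<bar>)" for \<omega>
      proof -
        have "riemann_A h (Suc N) \<omega> $ i - t = (\<Sum>k<Suc N. h * (exp_weights \<alpha> (B (real k * h) \<omega>) $ i - 1))"
          unfolding h(2)[symmetric] by (simp add: riemann_A_def sum_distrib_left[symmetric] sum_subtractf algebra_simps del: sum.lessThan_Suc)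
        then have "\<bar>riemann_A h (Suc N) \<omega> $ i - t\<bar> \<le> (\<Sum>k<Suc N. \<bar>h * (exp_weights \<alpha> (B (real k * h) \<omega>) $ i - 1)\<bar>)"
          by (simp only: sum_abs)
        also have "\<dots> = (\<Sum>k<Suc N. h * \<bar>exp_weights \<alpha> (B (real k * h) \<omega>) $ i - 1\<bar>)"
          using h(1) by (simp only: abs_mult abs_of_pos)
        finally have "f N \<omega> \<le> ennreal (\<Sum>k<Suc N. h * \<bar>exp_weights \<alpha> (B (real k * h) \<omega>) $ i - 1\<bar>)"
          unfolding f_def h_def[symmetric] by (rule ennreal_leI)
        also have "\<dots> = (\<Sum>k<Suc N. ennreal h * ennreal \<bar>exp_weights \<alpha> (B (real k * h) \<omega>) $ i - 1\<bar>)"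
          using h(1) by (subst sum_ennreal[symmetric]) (auto simp: ennreal_mult intro!: mult_nonneg_nonneg)
        finally show ?thesis .
      qed
      then have "(\<integral>\<^sup>+\<omega>. f N \<omega> \<partial>M) \<le> (\<integral>\<^sup>+\<omega>. (\<Sum>k<Suc N. ennreal h * ennreal \<bar>exp_weights \<alpha> (B (real k * h) \<omega>) $ i - 1\<bar>) \<partial>M)"
        by (intro nn_integral_mono)
      also have "\<dots> = (\<Sum>k<Suc N. ennreal h * (\<integral>\<^sup>+\<omega>. ennreal \<bar>exp_weights \<alpha> (B (real k * h) \<omega>) $ i - 1\<bar> \<partial>M))"
        by (subst nn_integral_sum) (auto simp: nn_integral_cmult simp del: sum.lessThan_Suc)
      also have "\<dots> \<le> (\<Sum>k<Suc N. ennreal h * ennreal e)"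
      proof (intro sum_mono mult_left_mono t0(2))
        fix k assume "k \<in> {..<Suc N}"
        then have "real k * h \<le> real (Suc N) * h" using h(1) by (intro mult_right_mono) auto
        then show "real k * h \<le> t0" using h(2) t by simp
      qed (use h in auto)
      also have "\<dots> = ennreal (e * t)"
      proof -
        have "(\<Sum>k<Suc N. ennreal h * ennreal e) = ennreal (real (Suc N)) * (ennreal h * ennreal e)"
          by (simp only: sum_constant card_lessThan ennreal_of_nat_eq_real_of_nat)
        also have "\<dots> = ennreal (real (Suc N) * (h * e))"
          using h e by (simp only: ennreal_mult mult_nonneg_nonneg less_imp_le of_nat_0_le_iff)
        also have "real (Suc N) * (h * e) = e * t" unfolding h(2)[symmetric] by simp
        finally show ?thesis .
      qed
      finally show ?thesis .
    qed
    have lim: "liminf (\<lambda>N. f N \<omega>) = ennreal \<bar>A_upto t \<omega> $ i - t\<bar>" if "\<omega> \<in> space M" for \<omega>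
    proof (rule lim_imp_Liminf)
      have "(\<lambda>N. riemann_A (t / real (Suc N)) (Suc N) \<omega>) \<longlonglongrightarrow> A_upto t \<omega>"
        using LIMSEQ_Suc[OF riemann_A_tendsto[OF t(1) zero_less_one that]] by simp
      then show "(\<lambda>N. f N \<omega>) \<longlonglongrightarrow> ennreal \<bar>A_upto t \<omega> $ i - t\<bar>"
        unfolding f_def by (intro tendsto_ennrealI tendsto_intros)
    qed simp
    have "(\<integral>\<^sup>+\<omega>. ennreal \<bar>A_upto t \<omega> $ i - t\<bar> \<partial>M) = (\<integral>\<^sup>+\<omega>. liminf (\<lambda>N. f N \<omega>) \<partial>M)"
      by (intro nn_integral_cong) (simp add: lim)
    also have "\<dots> \<le> liminf (\<lambda>N. \<integral>\<^sup>+\<omega>. f N \<omega> \<partial>M)" by (rule nn_integral_liminf) measurable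
    also have "\<dots> \<le> limsup (\<lambda>N. \<integral>\<^sup>+\<omega>. f N \<omega> \<partial>M)" by (rule Liminf_le_Limsup) simp
    also have "\<dots> \<le> ennreal (e * t)"
      by (rule Limsup_bounded) (simp add: bound)
    finally show ?thesis .
  qed
  then show ?thesis using t0(1) by blast
qed

lemma A_upto_nonneg: "\<omega> \<in> space M \<Longrightarrow> 0 \<le> A_upto t \<omega> $ i"
proof -
  assume w: "\<omega> \<in> space M"
  have "continuous_on {0..t} (\<lambda>s. exp (-2 * (\<alpha> i \<bullet> B s \<omega>)))"
    by (intro continuous_intros continuous_on_subset[OF B_cont[OF w]]) auto
  then have "0 \<le> integral {0..t} (\<lambda>s. exp (-2 * (\<alpha> i \<bullet> B s \<omega>)))"
    by (intro Henstock_Kurzweil_Integration.integral_nonneg integrable_continuous_real) auto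
  then show ?thesis by (simp add: A_upto_def)
qed

lemma h_small_time:
  fixes h :: "real ^ 'n \<Rightarrow> real"
  assumes cont: "continuous_on UNIV h" and bdd: "\<And>x. \<bar>h x\<bar> \<le> D" and r: "0 \<le> r"
  shows "(\<lambda>N. \<integral>\<omega>. h (x + B (r / real N) \<omega>) \<partial>M) \<longlonglongrightarrow> h x"
proof -
  have [measurable]: "h \<in> borel_measurable borel" by (rule borel_measurable_continuous_onI[OF cont])
  have Bm [measurable]: "B (r / real N) \<in> borel_measurable M" for N
    by (rule B_meas) (use r in simp)
  have "(\<lambda>N. \<integral>\<omega>. h (x + B (r / real N) \<omega>) \<partial>M) \<longlonglongrightarrow> (\<integral>\<omega>. h (x + 0) \<partial>M)"
  proof (rule integral_dominated_convergence[where w = "\<lambda>_. D"])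
    show "AE \<omega> in M. (\<lambda>N. h (x + B (r / real N) \<omega>)) \<longlonglongrightarrow> h (x + 0)"
    proof (rule AE_I2)
      fix \<omega> assume w: "\<omega> \<in> space M"
      have "(\<lambda>N. B (r / real N) \<omega>) \<longlonglongrightarrow> B 0 \<omega>"
        by (rule continuous_on_tendsto_compose[OF B_cont[OF w] lim_const_over_n]) (use r in auto)
      then have "(\<lambda>N. x + B (r / real N) \<omega>) \<longlonglongrightarrow> x + 0"
        unfolding B_0[OF w] by (rule tendsto_add[OF tendsto_const])
      then show "(\<lambda>N. h (x + B (r / real N) \<omega>)) \<longlonglongrightarrow> h (x + 0)"
        by (rule continuous_on_tendsto_compose[OF cont]) auto
    qed
  qed (auto simp: bdd)
  then show ?thesis by (simp add: prob_space)
qed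

text \<open>Over a time step \<open>t\<close> the Markov identity gives \<open>G(b) h(x) = G(b + t c) E + o(t)\<close> with \<open>c = c(x)\<close> and a factor \<open>E = E h(x + B\<^sub>t)\<close>
  that is the same for all base points \<open>b\<close>. Comparing two base points eliminates \<open>E\<close>, so the ratio of the values of
  \<open>G\<close> along two parallel rays changes by \<open>o(t)\<close> per step, hence by \<open>o(1)\<close> over \<open>r / t\<close> steps: it is constant.\<close>

lemma ray_shift_of_markov:
  fixes G :: "real ^ 'd \<Rightarrow> real" and h :: "real ^ 'n \<Rightarrow> real"
  assumes lip: "\<And>a a'. \<bar>G a - G a'\<bar> \<le> C * (\<Sum>i\<in>UNIV. \<bar>a $ i - a' $ i\<bar>)"
    and Gm: "G \<in> borel_measurable borel"
    and Gpos: "\<And>a. a \<in> orthant \<Longrightarrow> 0 < G a" and Gnn: "\<And>a. 0 \<le> G a" and Gle: "\<And>a. G a \<le> C"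
    and hcont: "continuous_on UNIV h" and hpos: "\<And>x. 0 < h x" and hle: "\<And>x. h x \<le> D"
    and markov: "\<And>a x t. a \<in> orthant \<Longrightarrow> 0 < t \<Longrightarrow>
        G a * h x = (\<integral>\<omega>. G (a + exp_weights \<alpha> x * A_upto t \<omega>) * h (x + B t \<omega>) \<partial>M)"
    and a: "a \<in> orthant" and a': "a' \<in> orthant" and r: "0 \<le> r"
  shows "G (a + r *\<^sub>R exp_weights \<alpha> x) * G a' = G a * G (a' + r *\<^sub>R exp_weights \<alpha> x)"
proof (cases "r = 0")
  case False
  with r have r: "0 < r" by simp
  have [measurable]: "h \<in> borel_measurable borel" by (rule borel_measurable_continuous_onI[OF hcont])
  have C: "0 \<le> C" using Gnn[of 0] Gle[of 0] by simp
  have D: "0 < D" using hpos[of 0] hle[of 0] by simp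
  define c where "c = exp_weights \<alpha> x"
  define E where "E t = (\<integral>\<omega>. h (x + B t \<omega>) \<partial>M)" for t
  have E_nn: "0 \<le> E t" for t unfolding E_def by (intro integral_nonneg_AE AE_I2 less_imp_le hpos)
  have ray: "b + s *\<^sub>R c \<in> orthant" if "b \<in> orthant" "0 \<le> s" for b s
    using that by (intro orthant_add) (auto simp: c_def)
  have E_le: "E t \<le> D" if "0 < t" for t
  proof -
    have [measurable]: "B t \<in> borel_measurable M" using that by (intro B_meas) simp
    have "E t \<le> (\<integral>\<omega>. D \<partial>M)" unfolding E_def
      by (rule Bochner_Integration.integral_mono)
         (auto intro!: integrable_const_bound[of _ D] simp: hle less_imp_le[OF hpos] abs_of_pos[OF hpos])
    then show ?thesis by (simp add: prob_space)
  qed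
  \<comment> \<open>On a short time step \<open>A_upto t\<close> may be replaced by \<open>t\<close> up to \<open>o(t)\<close>, uniformly in the base point.\<close>
  have step: "\<bar>G b * h x - G (b + t *\<^sub>R c) * E t\<bar> \<le> (C * D * (\<Sum>i\<in>UNIV. c $ i)) * (e * t)"
    if b: "b \<in> orthant" and t: "0 < t" and e: "0 < e"
      and near: "\<And>i. (\<integral>\<^sup>+\<omega>. ennreal \<bar>A_upto t \<omega> $ i - t\<bar> \<partial>M) \<le> ennreal (e * t)" for b t e
  proof -
    note [measurable] = Gm
    have [measurable]: "B t \<in> borel_measurable M" "A_upto t \<in> borel_measurable M" using t by (auto intro: B_meas A_upto_meas)
    have intA: "integrable M (\<lambda>\<omega>. \<bar>A_upto t \<omega> $ i - t\<bar>)" for i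
      by (rule integrableI_bounded) (use near[of i] in \<open>auto intro: le_less_trans\<close>)
    have EA: "(\<integral>\<omega>. \<bar>A_upto t \<omega> $ i - t\<bar> \<partial>M) \<le> e * t" for i
      using near[of i] e t nn_integral_eq_integral[OF intA[of i]] by simp
    have i1: "integrable M (\<lambda>\<omega>. G (b + c * A_upto t \<omega>) * h (x + B t \<omega>))"
      by (rule integrable_const_bound[of _ "C * D"])
         (auto simp: abs_mult Gnn less_imp_le[OF hpos] Gle hle C intro!: mult_mono)
    have i2: "integrable M (\<lambda>\<omega>. G (b + t *\<^sub>R c) * h (x + B t \<omega>))"
      by (rule integrable_const_bound[of _ "C * D"])
         (auto simp: abs_mult Gnn less_imp_le[OF hpos] Gle hle C intro!: mult_mono)
    have i3: "integrable M (\<lambda>\<omega>. C * D * (\<Sum>i\<in>UNIV. c $ i * \<bar>A_upto t \<omega> $ i - t\<bar>))"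
      by (intro integrable_mult_right Bochner_Integration.integrable_sum intA)
    have "G b * h x - G (b + t *\<^sub>R c) * E t =
        (\<integral>\<omega>. G (b + c * A_upto t \<omega>) * h (x + B t \<omega>) \<partial>M) - (\<integral>\<omega>. G (b + t *\<^sub>R c) * h (x + B t \<omega>) \<partial>M)"
      using markov[OF b t] by (simp add: E_def c_def)
    also have "\<dots> = (\<integral>\<omega>. (G (b + c * A_upto t \<omega>) - G (b + t *\<^sub>R c)) * h (x + B t \<omega>) \<partial>M)"
      by (subst Bochner_Integration.integral_diff[OF i1 i2, symmetric]) (simp add: left_diff_distrib)
    finally have "\<bar>G b * h x - G (b + t *\<^sub>R c) * E t\<bar> = norm (\<integral>\<omega>. (G (b + c * A_upto t \<omega>) - G (b + t *\<^sub>R c)) * h (x + B t \<omega>) \<partial>M)"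
      by simp
    also have "\<dots> \<le> (\<integral>\<omega>. C * D * (\<Sum>i\<in>UNIV. c $ i * \<bar>A_upto t \<omega> $ i - t\<bar>) \<partial>M)"
    proof (rule order_trans[OF integral_norm_bound Bochner_Integration.integral_mono])
      show "integrable M (\<lambda>\<omega>. norm ((G (b + c * A_upto t \<omega>) - G (b + t *\<^sub>R c)) * h (x + B t \<omega>)))"
        by (rule integrable_norm)
          (use Bochner_Integration.integrable_diff[OF i1 i2] in \<open>simp add: left_diff_distrib\<close>)
      show "norm ((G (b + c * A_upto t \<omega>) - G (b + t *\<^sub>R c)) * h (x + B t \<omega>))
          \<le> C * D * (\<Sum>i\<in>UNIV. c $ i * \<bar>A_upto t \<omega> $ i - t\<bar>)" for \<omega>
      proof -
        have "(\<Sum>i\<in>UNIV. \<bar>(b + c * A_upto t \<omega>) $ i - (b + t *\<^sub>R c) $ i\<bar>) = (\<Sum>i\<in>UNIV. c $ i * \<bar>A_upto t \<omega> $ i - t\<bar>)"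
        proof (rule sum.cong[OF refl])
          fix i
          have "(b + c * A_upto t \<omega>) $ i - (b + t *\<^sub>R c) $ i = c $ i * (A_upto t \<omega> $ i - t)" by (simp add: algebra_simps)
          then show "\<bar>(b + c * A_upto t \<omega>) $ i - (b + t *\<^sub>R c) $ i\<bar> = c $ i * \<bar>A_upto t \<omega> $ i - t\<bar>"
            by (simp only: abs_mult) (simp add: c_def)
        qed
        then have "\<bar>G (b + c * A_upto t \<omega>) - G (b + t *\<^sub>R c)\<bar> \<le> C * (\<Sum>i\<in>UNIV. c $ i * \<bar>A_upto t \<omega> $ i - t\<bar>)"
          using lip[of "b + c * A_upto t \<omega>" "b + t *\<^sub>R c"] by simp
        then have "\<bar>G (b + c * A_upto t \<omega>) - G (b + t *\<^sub>R c)\<bar> * h (x + B t \<omega>) \<le> (C * (\<Sum>i\<in>UNIV. c $ i * \<bar>A_upto t \<omega> $ i - t\<bar>)) * D"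
          using hpos hle C by (intro mult_mono) (auto intro!: mult_nonneg_nonneg sum_nonneg less_imp_le[OF hpos] simp: c_def)
        then show ?thesis using hpos[of "x + B t \<omega>"] by (simp add: abs_mult mult_ac)
      qed
    qed (rule i3)
    also have "\<dots> = C * D * (\<Sum>i\<in>UNIV. c $ i * (\<integral>\<omega>. \<bar>A_upto t \<omega> $ i - t\<bar> \<partial>M))"
      using intA by simp
    also have "\<dots> \<le> C * D * (\<Sum>i\<in>UNIV. c $ i * (e * t))"
      using C D by (intro mult_left_mono sum_mono EA) (auto simp: c_def)
    finally show ?thesis by (simp add: sum_distrib_right mult.assoc)
  qed
  obtain l where l: "0 < l" "\<And>s. 0 \<le> s \<Longrightarrow> s \<le> r \<Longrightarrow> l \<le> G (a' + s *\<^sub>R c)"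
  proof -
    have "continuous_on {0..r} (\<lambda>s. G (a' + s *\<^sub>R c))"
      unfolding continuous_on_def
      proof
        fix s assume "s \<in> {0..r}"
        have "((\<lambda>u. C * (\<Sum>i\<in>UNIV. \<bar>(a' + u *\<^sub>R c) $ i - (a' + s *\<^sub>R c) $ i\<bar>)) \<longlongrightarrow>
            C * (\<Sum>i\<in>UNIV. \<bar>(a' + s *\<^sub>R c) $ i - (a' + s *\<^sub>R c) $ i\<bar>)) (at s within {0..r})"
          by (intro tendsto_intros)
        then have lim0: "((\<lambda>u. C * (\<Sum>i\<in>UNIV. \<bar>(a' + u *\<^sub>R c) $ i - (a' + s *\<^sub>R c) $ i\<bar>)) \<longlongrightarrow> 0) (at s within {0..r})"
          by simp
        have "((\<lambda>u. G (a' + u *\<^sub>R c) - G (a' + s *\<^sub>R c)) \<longlongrightarrow> 0) (at s within {0..r})"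
          by (rule Lim_null_comparison[OF _ lim0], rule always_eventually, rule allI, unfold real_norm_def, rule lip)
        then show "((\<lambda>s. G (a' + s *\<^sub>R c)) \<longlongrightarrow> G (a' + s *\<^sub>R c)) (at s within {0..r})"
          by (simp add: LIM_zero_iff)
      qed
    then obtain s where "s \<in> {0..r}" "\<forall>u\<in>{0..r}. G (a' + s *\<^sub>R c) \<le> G (a' + u *\<^sub>R c)"
      using continuous_attains_inf[of "{0..r}" "\<lambda>s. G (a' + s *\<^sub>R c)"] r by auto
    then show ?thesis using that[of "G (a' + s *\<^sub>R c)"] Gpos[OF ray[OF a', of s]] by auto
  qed
  define \<kappa> where "\<kappa> = C * D * (\<Sum>i\<in>UNIV. c $ i)"
  have kappa: "0 \<le> \<kappa>" unfolding \<kappa>_def using C D by (intro mult_nonneg_nonneg sum_nonneg) (auto simp: c_def)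
  define K where "K = r * (4 * \<kappa> * C * D / (h x)\<^sup>2) / l\<^sup>2"
  have claim: "\<bar>G (a + r *\<^sub>R c) / G (a' + r *\<^sub>R c) - G a / G a'\<bar> \<le> e * K" if e: "0 < e" for e
  proof -
    obtain t0 where t0: "0 < t0" "\<And>t i. 0 < t \<Longrightarrow> t \<le> t0 \<Longrightarrow> (\<integral>\<^sup>+\<omega>. ennreal \<bar>A_upto t \<omega> $ i - t\<bar> \<partial>M) \<le> ennreal (e * t)"
      using A_upto_near[OF e] by blast
    have "eventually (\<lambda>N. h x / 2 < E (r / real N)) sequentially"
      unfolding E_def using hpos[of x] r hle
      by (intro order_tendstoD(1)[OF h_small_time[OF hcont, of D]]) (auto simp: abs_of_pos[OF hpos])
    moreover have "eventually (\<lambda>N. r / real N < t0) sequentially"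
      by (rule order_tendstoD(2)[OF lim_const_over_n t0(1)])
    ultimately have "eventually (\<lambda>N. h x / 2 < E (r / real N) \<and> r / real N < t0 \<and> 0 < N) sequentially"
      using eventually_gt_at_top[of 0] by eventually_elim simp
    then obtain N where N: "h x / 2 < E (r / real N)" "r / real N < t0" "0 < N"
      by (auto simp: eventually_sequentially)
    define t where "t = r / real N"
    have t: "0 < t" "t \<le> t0" "real N * t = r" using N r by (auto simp: t_def)
    have Et: "h x / 2 < E t" using N by (simp add: t_def)
    define u where "u k = G (a + (real k * t) *\<^sub>R c)" for k
    define u' where "u' k = G (a' + (real k * t) *\<^sub>R c)" for k
    have u': "l \<le> u' k" if "k \<le> N" for k
      unfolding u'_def using that t by (intro l(2)) (auto simp flip: t(3) intro!: mult_right_mono)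
    have inc: "\<bar>u (Suc k) / u' (Suc k) - u k / u' k\<bar> \<le> e * (K / real N)" if k: "k < N" for k
    proof -
      \<comment> \<open>\<open>P \<approx> Q\<close> and \<open>P' \<approx> Q'\<close>, and \<open>P Q' - Q P'\<close> is the cross difference of \<open>u\<close> and \<open>u'\<close> times \<open>h x * E t\<close>.\<close>
      define P where "P = u k * h x"
      define Q where "Q = u (Suc k) * E t"
      define P' where "P' = u' k * h x"
      define Q' where "Q' = u' (Suc k) * E t"
      have shift: "b + (real (Suc k) * t) *\<^sub>R c = b + (real k * t) *\<^sub>R c + t *\<^sub>R c" for b
        by (simp add: algebra_simps)
      have PQ: "\<bar>P - Q\<bar> \<le> \<kappa> * (e * t)" "\<bar>P' - Q'\<bar> \<le> \<kappa> * (e * t)"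
        unfolding P_def Q_def P'_def Q'_def u_def u'_def shift \<kappa>_def
        using t e by (intro step ray a a' t0(2); simp)+
      have Qb: "0 \<le> Q" "Q \<le> C * D" "0 \<le> Q'" "Q' \<le> C * D"
        unfolding Q_def Q'_def u_def u'_def using E_nn E_le[OF t(1)] C Gnn Gle by (auto intro!: mult_mono mult_nonneg_nonneg)
      have "P * Q' - Q * P' = (P - Q) * Q' - Q * (P' - Q')" by (simp add: algebra_simps)
      then have "\<bar>P * Q' - Q * P'\<bar> \<le> \<bar>P - Q\<bar> * Q' + Q * \<bar>P' - Q'\<bar>"
        using abs_triangle_ineq4[of "(P - Q) * Q'" "Q * (P' - Q')"] Qb by (simp add: abs_mult)
      also have "\<dots> \<le> (\<kappa> * (e * t)) * (C * D) + (C * D) * (\<kappa> * (e * t))"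
        using PQ Qb C D kappa e t by (intro add_mono mult_mono) auto
      finally have cross: "\<bar>P * Q' - Q * P'\<bar> \<le> 2 * \<kappa> * C * D * e * t" by (simp add: algebra_simps)
      have hE: "(h x)\<^sup>2 / 2 \<le> h x * E t"
        using Et hpos[of x] by (simp add: power2_eq_square)
      have "\<bar>u k * u' (Suc k) - u (Suc k) * u' k\<bar> * ((h x)\<^sup>2 / 2) \<le> \<bar>u k * u' (Suc k) - u (Suc k) * u' k\<bar> * (h x * E t)"
        by (intro mult_left_mono hE) simp
      also have "\<dots> = \<bar>P * Q' - Q * P'\<bar>"
      proof -
        have "P * Q' - Q * P' = (u k * u' (Suc k) - u (Suc k) * u' k) * (h x * E t)"
          by (simp add: P_def Q_def P'_def Q'_def algebra_simps)
        then show ?thesis using hpos[of x] E_nn[of t] by (simp add: abs_mult)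
      qed
      finally have X: "\<bar>u k * u' (Suc k) - u (Suc k) * u' k\<bar> * ((h x)\<^sup>2 / 2) \<le> 2 * \<kappa> * C * D * e * t"
        using cross by linarith
      have X2: "\<bar>u k * u' (Suc k) - u (Suc k) * u' k\<bar> \<le> (4 * \<kappa> * C * D / (h x)\<^sup>2) * (e * t)"
        using X hpos[of x] by (simp add: field_simps)
      have uk: "l \<le> u' k" "l \<le> u' (Suc k)" using k by (auto intro: u')
      then have ukp: "0 < u' k" "0 < u' (Suc k)" using l(1) by auto
      have ll: "l\<^sup>2 \<le> u' k * u' (Suc k)" unfolding power2_eq_square using uk l(1) by (intro mult_mono) auto
      have "u (Suc k) / u' (Suc k) - u k / u' k = - (u k * u' (Suc k) - u (Suc k) * u' k) / (u' k * u' (Suc k))"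
        using ukp by (simp add: field_simps)
      then have "\<bar>u (Suc k) / u' (Suc k) - u k / u' k\<bar> = \<bar>u k * u' (Suc k) - u (Suc k) * u' k\<bar> / (u' k * u' (Suc k))"
        using ukp by (simp add: abs_divide abs_mult)
      also have "\<dots> \<le> (4 * \<kappa> * C * D / (h x)\<^sup>2) * (e * t) / l\<^sup>2"
        using X2 ll l(1) by (intro frac_le) (auto intro: order_trans[OF abs_ge_zero X2])
      also have "\<dots> = e * (K / real N)" using N(3) by (simp add: K_def t_def field_simps)
      finally show ?thesis .
    qed
    have tele: "\<bar>u k / u' k - u 0 / u' 0\<bar> \<le> real k * (e * (K / real N))" if "k \<le> N" for k
      using that
    proof (induction k)
      case (Suc k)
      have "\<bar>u (Suc k) / u' (Suc k) - u 0 / u' 0\<bar> \<le> \<bar>u (Suc k) / u' (Suc k) - u k / u' k\<bar> + \<bar>u k / u' k - u 0 / u' 0\<bar>" by linarith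
      also have "\<dots> \<le> e * (K / real N) + real k * (e * (K / real N))"
        using Suc by (intro add_mono inc) auto
      finally show ?case by (simp add: distrib_right del: times_divide_eq_right)
    qed simp
    from tele[of N] show ?thesis using N(3) t(3) by (simp add: u_def u'_def)
  qed
  have K: "0 \<le> K" unfolding K_def using r kappa C D by simp
  have "G (a + r *\<^sub>R c) / G (a' + r *\<^sub>R c) = G a / G a'"
  proof (rule ccontr)
    assume "G (a + r *\<^sub>R c) / G (a' + r *\<^sub>R c) \<noteq> G a / G a'"
    then have d: "0 < \<bar>G (a + r *\<^sub>R c) / G (a' + r *\<^sub>R c) - G a / G a'\<bar>" (is "0 < ?d") by simp
    have "?d \<le> ?d / (2 * (K + 1)) * K" by (rule claim) (use d K in simp)
    also have "\<dots> = ?d * (K / (2 * (K + 1)))" by simp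
    also have "\<dots> < ?d * 1" using d K by (intro mult_strict_left_mono) (auto simp: field_simps)
    finally show False by simp
  qed
  then show ?thesis
    using Gpos[OF a'] Gpos[OF ray[OF a' less_imp_le[OF r]]] by (simp add: frac_eq_eq c_def)
qed simp

end

section \<open>Expectations of functions of the perpetual functional\<close>

locale exp_functional = drifted_bm M \<alpha> \<mu> W B
  for M :: "'w measure" and \<alpha> :: "'d::finite \<Rightarrow> real ^ 'n" and \<mu> :: "real ^ 'n"
    and W B :: "real \<Rightarrow> 'w \<Rightarrow> real ^ 'n" +
  assumes A_meas [measurable]: "A_infty \<alpha> B \<in> borel_measurable M"
    and A_orthant: "AE \<omega> in M. A_infty \<alpha> B \<omega> \<in> orthant"
begin

definition Phi :: "(real ^ 'd \<Rightarrow> real) \<Rightarrow> real ^ 'd \<Rightarrow> real ^ 'n \<Rightarrow> real" where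
  "Phi V a x = (\<integral>\<omega>. V (a + exp_weights \<alpha> x * A_infty \<alpha> B \<omega>) \<partial>M)"

lemma AE_shift_orthant:
  assumes "a \<in> orthant"
  shows "AE \<omega> in M. a + exp_weights \<alpha> x * A_infty \<alpha> B \<omega> \<in> orthant"
  using A_orthant by eventually_elim (rule orthant_add[OF assms], auto simp: orthant_def less_imp_le)

lemma Phi_integrable:
  assumes "bounded_weight V C"
  shows "integrable M (\<lambda>\<omega>. V (a + exp_weights \<alpha> x * A_infty \<alpha> B \<omega>))"
proof -
  interpret V: bounded_weight V C by (rule assms)
  show ?thesis by (rule integrable_const_bound[of _ C]) (auto simp: V.v_nonneg V.v_le)
qed

lemma Phi_le:
  assumes "bounded_weight V C"
  shows "Phi V a x \<le> C"
proof -
  interpret V: bounded_weight V C by (rule assms)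
  have "Phi V a x \<le> (\<integral>\<omega>. C \<partial>M)"
    unfolding Phi_def by (rule Bochner_Integration.integral_mono[OF Phi_integrable[OF assms]]) (auto simp: V.v_le)
  then show ?thesis by (simp add: prob_space)
qed

lemma Phi_nonneg:
  assumes "bounded_weight V C"
  shows "0 \<le> Phi V a x"
proof -
  interpret V: bounded_weight V C by (rule assms)
  show ?thesis unfolding Phi_def by (rule integral_nonneg_AE) (simp add: V.v_nonneg)
qed

lemma Phi_pos:
  assumes "bounded_weight V C" and "\<And>y. y \<in> orthant \<Longrightarrow> 0 < V y" and "a \<in> orthant"
  shows "0 < Phi V a x"
  unfolding Phi_def
proof (rule expectation_greater[OF Phi_integrable[OF assms(1)]])
  show "AE \<omega> in M. 0 < V (a + exp_weights \<alpha> x * A_infty \<alpha> B \<omega>)"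
    using AE_shift_orthant[OF assms(3)] by eventually_elim (rule assms(2))
qed

text \<open>Averaging acts on the argument \<open>a\<close> alone, so it preserves a factorisation into a function of \<open>a\<close> and one of \<open>x\<close>.\<close>

lemma Phi_exp_average:
  assumes "bounded_weight v C"
  shows "Phi (exp_average v) a x = (\<integral>b. Phi v (a + b) x \<partial>exp_law)"
proof -
  interpret v: bounded_weight v C by (rule assms)
  interpret E: prob_space "exp_law :: (real ^ 'd) measure" by (rule prob_space_exp_law)
  interpret P: pair_prob_space M "exp_law :: (real ^ 'd) measure" ..
  have int: "integrable (M \<Otimes>\<^sub>M exp_law) (\<lambda>(\<omega>, b). v (a + exp_weights \<alpha> x * A_infty \<alpha> B \<omega> + b))"
    by (rule P.integrable_const_bound[of _ C]) (auto simp: v.v_nonneg v.v_le split_beta)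
  have "Phi (exp_average v) a x = (\<integral>\<omega>. \<integral>b. v (a + exp_weights \<alpha> x * A_infty \<alpha> B \<omega> + b) \<partial>exp_law \<partial>M)"
    by (simp add: Phi_def exp_average_def)
  also have "\<dots> = (\<integral>b. \<integral>\<omega>. v (a + exp_weights \<alpha> x * A_infty \<alpha> B \<omega> + b) \<partial>M \<partial>exp_law)"
    by (rule P.Fubini_integral[OF int, symmetric])
  also have "\<dots> = (\<integral>b. Phi v (a + b) x \<partial>exp_law)"
    by (simp add: Phi_def add_ac)
  finally show ?thesis .
qed

lemma Phi_markov:
  assumes t: "0 < t" and V: "continuous_on UNIV V" and bw: "bounded_weight V C"
  shows "Phi V a x = (\<integral>\<omega>. Phi V (a + exp_weights \<alpha> x * A_upto t \<omega>) (x + B t \<omega>) \<partial>M)"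
proof -
  interpret V: bounded_weight V C by (rule bw)
  have "\<bar>V y\<bar> \<le> C" for y using V.v_nonneg V.v_le by simp
  from markov_A_infty[OF t V this A_meas A_orthant]
  show ?thesis unfolding Phi_def exp_weights_add by (simp add: mult.assoc)
qed

text \<open>Along the drift every \<open>\<alpha>\<^sub>i\<close> tends to infinity, so the random perturbation of \<open>a\<close> disappears.\<close>

lemma Phi_tendsto:
  assumes mu: "\<mu> \<in> Omega \<alpha>" and V: "continuous_on UNIV V" and bw: "bounded_weight V C"
  shows "(\<lambda>n. Phi V a (real n *\<^sub>R \<mu>)) \<longlonglongrightarrow> V a"
proof -
  interpret V: bounded_weight V C by (rule bw)
  have [measurable]: "V \<in> borel_measurable borel" by (rule V.v_meas)
  have "(\<lambda>n. exp_weights \<alpha> (real n *\<^sub>R \<mu>)) \<longlonglongrightarrow> 0"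
  proof (rule vec_tendstoI)
    fix i
    have "(\<lambda>n. exp (real n * (-2 * (\<alpha> i \<bullet> \<mu>)))) \<longlonglongrightarrow> 0"
      using mu by (intro exp_at_bot_tendsto_0) (simp add: Omega_def)
    then show "(\<lambda>n. exp_weights \<alpha> (real n *\<^sub>R \<mu>) $ i) \<longlonglongrightarrow> 0 $ i" by (simp add: mult_ac)
  qed
  then have lim: "(\<lambda>n. a + exp_weights \<alpha> (real n *\<^sub>R \<mu>) * A_infty \<alpha> B \<omega>) \<longlonglongrightarrow> a + 0 * A_infty \<alpha> B \<omega>" for \<omega>
    by (intro tendsto_intros)
  have "(\<lambda>n. Phi V a (real n *\<^sub>R \<mu>)) \<longlonglongrightarrow> (\<integral>\<omega>. V a \<partial>M)"
    unfolding Phi_def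
  proof (rule integral_dominated_convergence[where w = "\<lambda>_. C"])
    show "AE \<omega> in M. (\<lambda>n. V (a + exp_weights \<alpha> (real n *\<^sub>R \<mu>) * A_infty \<alpha> B \<omega>)) \<longlonglongrightarrow> V a"
      using continuous_on_tendsto_compose[OF V lim] by (intro AE_I2) simp
  qed (auto simp: V.v_nonneg V.v_le)
  then show ?thesis by (simp add: prob_space)
qed

end

section \<open>Factorised expectations force an exponential\<close>

text \<open>The heart of the converse direction: \<open>V\<close> is the averaged weight and \<open>G\<close> its expectation at \<open>x = 0\<close>. First \<open>G\<close> is
  shown to be an exponential; the limit \<open>x \<rightarrow> \<infinity>\<close> along the drift then transfers this to \<open>V\<close>, and inverting the average
  transfers it to \<open>v\<close>.\<close>

lemma (in exp_functional) exponential_of_factorization: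
  assumes mu: "\<mu> \<in> Omega \<alpha>" and inj: "inj \<alpha>"
    and bw: "bounded_weight v C" and pos: "\<And>y. y \<in> orthant \<Longrightarrow> 0 < v y"
    and out: "\<And>y. y \<notin> orthant \<Longrightarrow> v y = 0"
    and hcont: "continuous_on UNIV h" and hpos: "\<And>x. 0 < h x"
    and fact: "\<And>a x. a \<in> orthant \<Longrightarrow> Phi v a x = Phi v a 0 * h x"
  obtains l :: "real ^ 'd" and k where "\<And>i. 0 \<le> l $ i"
    "AE y in lborel. v y = k * (indicator orthant y * exp (- (l \<bullet> y)))"
proof -
  interpret v: bounded_weight v C by (rule bw)
  have one: "(1 :: real ^ 'd) \<in> orthant" by (simp add: orthant_def)
  define V where "V = exp_average v"
  have bwV: "bounded_weight V C" unfolding V_def by (rule exp_average_bounded_weight[OF bw])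
  interpret V: bounded_weight V C by (rule bwV)
  have Vcont: "continuous_on UNIV V"
    unfolding V_def continuous_on_def by (auto intro!: v.exp_average_tendsto tendsto_ident_at)
  define G where "G a = Phi V a 0" for a
  have GV: "Phi V a x = G a * h x" if a: "a \<in> orthant" for a x
  proof -
    have "Phi V a x = (\<integral>b. Phi v (a + b) 0 * h x \<partial>exp_law)"
      unfolding V_def Phi_exp_average[OF bw]
    proof (rule integral_cong_AE)
      show "AE b in exp_law. Phi v (a + b) x = Phi v (a + b) 0 * h x"
        using AE_exp_law_orthant
        by eventually_elim (intro fact orthant_add[OF a], auto simp: orthant_def less_imp_le)
    qed (unfold Phi_def, measurable)
    then show ?thesis unfolding G_def V_def Phi_exp_average[OF bw] by simp
  qed
  have hle: "h x \<le> C / G 1" for x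
    using Phi_le[OF bwV, of 1 x] GV[OF one, of x] Phi_pos[OF bwV _ one, of 0] exp_average_pos[OF bw pos]
    by (simp add: G_def V_def field_simps)
  have lipG: "\<bar>G a - G a'\<bar> \<le> C * (\<Sum>i\<in>UNIV. \<bar>a $ i - a' $ i\<bar>)" for a a'
  proof -
    have "\<bar>G a - G a'\<bar> = norm (\<integral>\<omega>. V (a + exp_weights \<alpha> 0 * A_infty \<alpha> B \<omega>) - V (a' + exp_weights \<alpha> 0 * A_infty \<alpha> B \<omega>) \<partial>M)"
      unfolding G_def Phi_def
      by (subst Bochner_Integration.integral_diff) (auto simp only: Phi_integrable[OF bwV] real_norm_def)
    also have "\<dots> \<le> (\<integral>\<omega>. C * (\<Sum>i\<in>UNIV. \<bar>a $ i - a' $ i\<bar>) \<partial>M)"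
    proof (rule order_trans[OF integral_norm_bound Bochner_Integration.integral_mono])
      show "integrable M (\<lambda>\<omega>. norm (V (a + exp_weights \<alpha> 0 * A_infty \<alpha> B \<omega>) - V (a' + exp_weights \<alpha> 0 * A_infty \<alpha> B \<omega>)))"
        by (intro integrable_norm Bochner_Integration.integrable_diff Phi_integrable[OF bwV])
      show "norm (V (a + exp_weights \<alpha> 0 * A_infty \<alpha> B \<omega>) - V (a' + exp_weights \<alpha> 0 * A_infty \<alpha> B \<omega>)) \<le> C * (\<Sum>i\<in>UNIV. \<bar>a $ i - a' $ i\<bar>)" for \<omega>
        using v.exp_average_lipschitz[of "a + exp_weights \<alpha> 0 * A_infty \<alpha> B \<omega>" "a' + exp_weights \<alpha> 0 * A_infty \<alpha> B \<omega>"] by (simp add: V_def)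
    qed simp
    finally show ?thesis by (simp add: prob_space)
  qed
  have Gm: "G \<in> borel_measurable borel" unfolding G_def Phi_def by measurable
  have Gpos: "0 < G a" if "a \<in> orthant" for a
    unfolding G_def by (rule Phi_pos[OF bwV _ that]) (simp add: V_def exp_average_pos[OF bw pos])
  have markov: "G a * h x = (\<integral>\<omega>. G (a + exp_weights \<alpha> x * A_upto t \<omega>) * h (x + B t \<omega>) \<partial>M)" if "a \<in> orthant" "0 < t" for a x t
  proof -
    have "Phi V (a + exp_weights \<alpha> x * A_upto t \<omega>) (x + B t \<omega>) = G (a + exp_weights \<alpha> x * A_upto t \<omega>) * h (x + B t \<omega>)" if "\<omega> \<in> space M" for \<omega>
      by (intro GV orthant_add[OF \<open>a \<in> orthant\<close>]) (simp add: A_upto_nonneg that)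
    then show ?thesis
      using Phi_markov[OF that(2) Vcont bwV, of a x] GV[OF that(1), of x]
      by (simp cong: Bochner_Integration.integral_cong)
  qed
  obtain l K where l: "\<And>i. 0 \<le> l $ i" "0 < K" "\<And>a. a \<in> orthant \<Longrightarrow> G a = K * exp (- (l \<bullet> a))"
  proof (rule exponential_of_ray_shifts[of G C "range (exp_weights \<alpha>)"])
    show "G (a + r *\<^sub>R c) * G a' = G a * G (a' + r *\<^sub>R c)"
      if "a \<in> orthant" "a' \<in> orthant" "c \<in> range (exp_weights \<alpha>)" "0 \<le> r" for a a' c r
      using that ray_shift_of_markov[OF lipG Gm Gpos _ _ hcont hpos hle markov that(1,2,4)] Phi_nonneg[OF bwV] Phi_le[OF bwV]
      by (auto simp: G_def)
    show "G a \<le> C" for a unfolding G_def by (rule Phi_le[OF bwV])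
  qed (auto simp: Gpos span_exp_weights[OF inj] exp_weights_orthant)
  have VG: "V a * G 1 = V 1 * G a" if a: "a \<in> orthant" for a
  proof (rule LIMSEQ_unique)
    show "(\<lambda>n. Phi V a (real n *\<^sub>R \<mu>) * G 1) \<longlonglongrightarrow> V a * G 1"
      by (intro tendsto_intros Phi_tendsto[OF mu Vcont bwV])
    have "Phi V a (real n *\<^sub>R \<mu>) * G 1 = Phi V 1 (real n *\<^sub>R \<mu>) * G a" for n
      using GV[OF a] GV[OF one] by simp
    then show "(\<lambda>n. Phi V a (real n *\<^sub>R \<mu>) * G 1) \<longlonglongrightarrow> V 1 * G a"
      by (simp only:) (intro tendsto_intros Phi_tendsto[OF mu Vcont bwV])
  qed
  define e where "e y = (indicator orthant y * exp (- (l \<bullet> y)) :: real)" for y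
  obtain k1 where k1: "0 < k1" "\<And>a. a \<in> orthant \<Longrightarrow> exp_average e a = k1 * exp (- (l \<bullet> a))"
    using exp_average_exp[of l] l(1) unfolding e_def by blast
  \<comment> \<open>\<open>V = (V 1 / G 1) G\<close> on the orthant, \<open>G\<close> has the constant \<open>K\<close>, and averaging \<open>e\<close> produces the factor \<open>k1\<close>.\<close>
  define k where "k = V 1 / G 1 * K / k1"
  have k: "0 \<le> k" unfolding k_def using l(2) k1(1) Gpos[OF one] V.v_nonneg[of 1] by simp
  have exp_average_ke: "exp_average (\<lambda>y. k * e y) a = k * exp_average e a" for a by (simp add: exp_average_def)
  have "AE y in lborel. v y = k * e y"
  proof (rule exp_average_determines[OF bw])
    show "bounded_weight (\<lambda>y. k * e y) k"
    proof
      fix y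
      show "0 \<le> k * e y" using k by (simp add: e_def)
      have "0 \<le> l \<bullet> y" if "y \<in> orthant" unfolding inner_vec_def
        by (intro sum_nonneg) (use l that in \<open>auto simp: orthant_def less_imp_le\<close>)
      then show "k * e y \<le> k" using k by (auto simp: e_def indicator_def mult_left_le)
    qed (simp add: e_def)
    fix a :: "real ^ 'd" assume a: "a \<in> orthant"
    show "exp_average v a = exp_average (\<lambda>y. k * e y) a"
    proof -
      have "exp_average (\<lambda>y. k * e y) a = (k * k1) * exp (- (l \<bullet> a))" by (simp add: exp_average_ke k1(2)[OF a])
      also have "k * k1 = V 1 / G 1 * K" using k1(1) by (simp add: k_def)
      also have "V 1 / G 1 * K * exp (- (l \<bullet> a)) = V 1 * G a / G 1" by (simp add: l(3)[OF a])
      also have "\<dots> = V a" using VG[OF a] Gpos[OF one] by (simp add: field_simps)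
      finally show ?thesis by (simp add: V_def)
    qed
  qed (auto simp: out e_def)
  then show ?thesis using that[of l k] l(1) by (simp add: e_def)
qed

section \<open>The Laplace transform of the perpetual functional\<close>

text \<open>A uniform gradient bound makes the difference quotients bounded by \<open>2 L\<close>, which allows dominated convergence.\<close>

lemma (in prob_space) GDERIV_expectation:
  fixes f :: "'x::euclidean_space \<Rightarrow> 'a \<Rightarrow> real"
  assumes deriv: "\<And>\<omega> x. \<omega> \<in> space M \<Longrightarrow> GDERIV (\<lambda>x. f x \<omega>) x :> g x \<omega>"
    and gb: "\<And>\<omega> x. \<omega> \<in> space M \<Longrightarrow> norm (g x \<omega>) \<le> L"
    and fint: "\<And>x. integrable M (f x)" and gm: "\<And>x. g x \<in> borel_measurable M"
  shows "GDERIV (\<lambda>x. \<integral>\<omega>. f x \<omega> \<partial>M) x :> (\<integral>\<omega>. g x \<omega> \<partial>M)"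
proof -
  have gint: "integrable M (g x)"
    by (rule integrable_const_bound[of _ L]) (auto intro: gm gb)
  have lip: "\<bar>f y \<omega> - f x \<omega>\<bar> \<le> L * norm (y - x)" if "\<omega> \<in> space M" for y \<omega>
  proof -
    have "norm (f y \<omega> - f x \<omega>) \<le> L * norm (y - x)"
    proof (rule differentiable_bound[of UNIV])
      show "((\<lambda>x. f x \<omega>) has_derivative (\<lambda>h. h \<bullet> g z \<omega>)) (at z within UNIV)" for z
        using deriv[OF that, of z] by (simp add: gderiv_def)
      show "onorm (\<lambda>h. h \<bullet> g z \<omega>) \<le> L" for z
      proof (rule onorm_le)
        fix h
        have "norm (h \<bullet> g z \<omega>) \<le> norm h * norm (g z \<omega>)" by (rule Cauchy_Schwarz_ineq2[unfolded real_norm_def[symmetric]])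
        also have "\<dots> \<le> L * norm h" using mult_left_mono[OF gb[OF that, of z], of "norm h"] by (simp add: mult.commute)
        finally show "norm (h \<bullet> g z \<omega>) \<le> L * norm h" .
      qed
    qed auto
    then show ?thesis by simp
  qed
  define R where "R y \<omega> = (f y \<omega> - f x \<omega> - (y - x) \<bullet> g x \<omega>) / norm (y - x)" for y \<omega>
  have Rint: "integrable M (R y)" for y
    unfolding R_def[abs_def]
    by (intro integrable_divide Bochner_Integration.integrable_diff integrable_inner_right fint gint) 
  have Rb: "\<bar>R y \<omega>\<bar> \<le> 2 * L" if w: "\<omega> \<in> space M" for y \<omega>
  proof (cases "y = x")
    case True
    then show ?thesis using order_trans[OF norm_ge_zero gb[OF w, of x]] by (simp add: R_def)
  next
    case False
    have "\<bar>(y - x) \<bullet> g x \<omega>\<bar> \<le> norm (y - x) * norm (g x \<omega>)" by (rule Cauchy_Schwarz_ineq2)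
    also have "\<dots> \<le> L * norm (y - x)" using mult_left_mono[OF gb[OF w, of x], of "norm (y - x)"] by (simp add: mult.commute)
    finally have "\<bar>f y \<omega> - f x \<omega> - (y - x) \<bullet> g x \<omega>\<bar> \<le> 2 * L * norm (y - x)"
      using lip[OF w, of y] by linarith
    then show ?thesis using False by (simp add: R_def abs_divide field_simps)
  qed
  have Rlim: "((\<lambda>y. R y \<omega>) \<longlongrightarrow> 0) (at x)" if w: "\<omega> \<in> space M" for \<omega>
  proof -
    have "((\<lambda>y. norm (f y \<omega> - f x \<omega> - (y - x) \<bullet> g x \<omega>) / norm (y - x)) \<longlongrightarrow> 0) (at x)"
      using deriv[OF w, of x] by (simp add: gderiv_def has_derivative_iff_norm)
    then have "((\<lambda>y. norm (R y \<omega>)) \<longlongrightarrow> 0) (at x)"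
      by (simp add: R_def abs_divide)
    then show ?thesis by (rule tendsto_norm_zero_cancel)
  qed
  have "((\<lambda>y. \<integral>\<omega>. R y \<omega> \<partial>M) \<longlongrightarrow> 0) (at x)"
    unfolding tendsto_at_iff_sequentially
  proof (intro allI impI)
    fix X assume X: "\<forall>n. X n \<in> UNIV - {x}" "X \<longlonglongrightarrow> x"
    have "(\<lambda>n. \<integral>\<omega>. R (X n) \<omega> \<partial>M) \<longlonglongrightarrow> (\<integral>\<omega>. 0 \<partial>M)"
    proof (rule integral_dominated_convergence[where w = "\<lambda>_. 2 * L"])
      show "R (X n) \<in> borel_measurable M" for n using Rint by auto
      show "AE \<omega> in M. (\<lambda>n. R (X n) \<omega>) \<longlonglongrightarrow> 0"
      proof (rule AE_I2)
        fix \<omega> assume "\<omega> \<in> space M"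
        from Rlim[OF this] X show "(\<lambda>n. R (X n) \<omega>) \<longlonglongrightarrow> 0"
          unfolding tendsto_at_iff_sequentially comp_def by blast
      qed
      show "AE \<omega> in M. norm (R (X n) \<omega>) \<le> 2 * L" for n using Rb by auto
    qed auto
    then show "((\<lambda>y. \<integral>\<omega>. R y \<omega> \<partial>M) \<circ> X) \<longlonglongrightarrow> 0" by (simp add: comp_def)
  qed
  moreover have "(\<integral>\<omega>. R y \<omega> \<partial>M) =
      ((\<integral>\<omega>. f y \<omega> \<partial>M) - (\<integral>\<omega>. f x \<omega> \<partial>M) - (y - x) \<bullet> (\<integral>\<omega>. g x \<omega> \<partial>M)) / norm (y - x)" for y
    unfolding R_def using fint gint by simp
  ultimately have "((\<lambda>y. ((\<integral>\<omega>. f y \<omega> \<partial>M) - (\<integral>\<omega>. f x \<omega> \<partial>M) - (y - x) \<bullet> (\<integral>\<omega>. g x \<omega> \<partial>M)) / norm (y - x)) \<longlongrightarrow> 0) (at x)"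
    by simp
  from tendsto_norm_zero[OF this] show ?thesis
    by (simp add: gderiv_def has_derivative_iff_norm abs_divide bounded_linear_inner_left)
qed

context exp_functional
begin

definition laplace_A :: "real ^ 'd \<Rightarrow> real ^ 'n \<Rightarrow> real" where
  "laplace_A l x = (\<integral>\<omega>. exp (- (l \<bullet> (exp_weights \<alpha> x * A_infty \<alpha> B \<omega>))) \<partial>M)"

lemma inner_exp_weights_A_nonneg:
  assumes "\<And>i. 0 \<le> l $ i"
  shows "0 \<le> l \<bullet> (exp_weights \<alpha> x * A_infty \<alpha> B \<omega>)"
  unfolding inner_vec_def by (intro sum_nonneg) (simp add: assms A_infty_nonneg)

lemma laplace_A_integrable:
  assumes "\<And>i. 0 \<le> l $ i"
  shows "integrable M (\<lambda>\<omega>. exp (- (l \<bullet> (exp_weights \<alpha> x * A_infty \<alpha> B \<omega>))))"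
  by (rule integrable_const_bound[of _ 1]) (auto simp: inner_exp_weights_A_nonneg[OF assms])

lemma laplace_A_pos:
  assumes "\<And>i. 0 \<le> l $ i"
  shows "0 < laplace_A l x"
  unfolding laplace_A_def by (rule expectation_greater[OF laplace_A_integrable[OF assms]]) simp

text \<open>The gradient of the integrand is bounded uniformly in the path because \<open>u e\<^sup>-\<^sup>u \<le> 1\<close> for \<open>u \<ge> 0\<close>.\<close>

lemma laplace_A_GDERIV:
  assumes l: "\<And>i. 0 \<le> l $ i"
  shows "\<exists>D. GDERIV (laplace_A l) x :> D"
proof -
  define f where "f x \<omega> = exp (- (l \<bullet> (exp_weights \<alpha> x * A_infty \<alpha> B \<omega>)))" for x \<omega>
  define g where "g x \<omega> = (\<Sum>i\<in>UNIV. (2 * (l $ i * exp (-2 * (\<alpha> i \<bullet> x)) * A_infty \<alpha> B \<omega> $ i) * f x \<omega>) *\<^sub>R \<alpha> i)" for x \<omega>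
  have "GDERIV (\<lambda>x. \<integral>\<omega>. f x \<omega> \<partial>M) x :> (\<integral>\<omega>. g x \<omega> \<partial>M)"
  proof (rule GDERIV_expectation[where L = "\<Sum>i\<in>UNIV. 2 * norm (\<alpha> i)"])
    define u where "u x \<omega> i = l $ i * exp (-2 * (\<alpha> i \<bullet> x)) * A_infty \<alpha> B \<omega> $ i" for x \<omega> i
    have fu: "f x \<omega> = exp (- (\<Sum>i\<in>UNIV. u x \<omega> i))" for x \<omega>
      by (simp add: f_def u_def inner_vec_def mult.assoc)
    have gu: "g x \<omega> = (\<Sum>i\<in>UNIV. (2 * u x \<omega> i * f x \<omega>) *\<^sub>R \<alpha> i)" for x \<omega>
      by (simp add: g_def u_def)
    show "GDERIV (\<lambda>x. f x \<omega>) x :> g x \<omega>" for \<omega> x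
    proof -
      have du: "((\<lambda>x. u x \<omega> i) has_derivative (\<lambda>h. - (h \<bullet> ((2 * u x \<omega> i) *\<^sub>R \<alpha> i)))) (at x)" for i
      proof -
        have "((\<lambda>x. exp (-2 * (\<alpha> i \<bullet> x))) has_derivative (\<lambda>h. (-2 * (\<alpha> i \<bullet> h)) * exp (-2 * (\<alpha> i \<bullet> x)))) (at x)"
          by (intro has_derivative_exp has_derivative_mult_right has_derivative_inner_right has_derivative_ident)
        from has_derivative_mult_left[OF has_derivative_mult_right[OF this, of "l $ i"], of "A_infty \<alpha> B \<omega> $ i"]
        show ?thesis unfolding u_def
          by (rule has_derivative_eq_rhs) (simp add: fun_eq_iff inner_commute mult_ac)
      qed
      have "((\<lambda>x. exp (- (\<Sum>i\<in>UNIV. u x \<omega> i))) has_derivative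
          (\<lambda>h. (- (\<Sum>i\<in>UNIV. - (h \<bullet> ((2 * u x \<omega> i) *\<^sub>R \<alpha> i)))) * exp (- (\<Sum>i\<in>UNIV. u x \<omega> i)))) (at x)"
        by (intro has_derivative_exp has_derivative_minus has_derivative_sum du)
      then have "((\<lambda>x. f x \<omega>) has_derivative (\<lambda>h. h \<bullet> g x \<omega>)) (at x)"
        unfolding fu[symmetric] gu
        by (rule has_derivative_eq_rhs) (simp add: fun_eq_iff inner_sum_right sum_negf sum_distrib_left mult_ac)
      then show ?thesis by (simp only: gderiv_def)
    qed
    show "norm (g x \<omega>) \<le> (\<Sum>i\<in>UNIV. 2 * norm (\<alpha> i))" for \<omega> x
      unfolding gu
    proof (rule order_trans[OF norm_sum sum_mono])
      fix i
      have u0: "0 \<le> u x \<omega> j" for j unfolding u_def by (simp add: l A_infty_nonneg)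
      define s where "s = (\<Sum>j\<in>UNIV. u x \<omega> j)"
      have "u x \<omega> i \<le> s" unfolding s_def by (rule member_le_sum) (simp_all add: u0)
      also have "s \<le> exp s" using exp_ge_add_one_self[of s] by linarith
      finally have "u x \<omega> i * exp (- s) \<le> exp s * exp (- s)" by (rule mult_right_mono) simp
      then have le1: "u x \<omega> i * f x \<omega> \<le> 1" by (simp add: fu s_def[symmetric] exp_minus)
      have nn: "0 \<le> u x \<omega> i * f x \<omega>" using u0[of i] by (simp add: fu)
      have "norm ((2 * u x \<omega> i * f x \<omega>) *\<^sub>R \<alpha> i) = 2 * (u x \<omega> i * f x \<omega>) * norm (\<alpha> i)"
        unfolding norm_scaleR mult.assoc abs_mult[of 2] abs_of_nonneg[OF nn] by simp
      also have "\<dots> \<le> 2 * 1 * norm (\<alpha> i)"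
        using le1 by (intro mult_right_mono mult_left_mono) auto
      finally show "norm ((2 * u x \<omega> i * f x \<omega>) *\<^sub>R \<alpha> i) \<le> 2 * norm (\<alpha> i)" by simp
    qed
    show "integrable M (f x)" for x unfolding f_def[abs_def] by (rule laplace_A_integrable[OF l])
    show "g x \<in> borel_measurable M" for x unfolding g_def f_def by measurable
  qed
  then show ?thesis by (auto simp: laplace_A_def[abs_def] f_def)
qed

end

section \<open>The characterisation\<close>

lemma AE_lborel_affine:
  fixes c :: "real ^ 'd"
  assumes P: "AE y in lborel. P y" and c: "\<And>i. c $ i \<noteq> 0"
  shows "AE z in lborel. P (a + c * z)"
proof -
  define T where "T x = a + (\<Sum>j\<in>Basis. ((c \<bullet> j) * (x \<bullet> j)) *\<^sub>R j)" for x :: "real ^ 'd"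
  have T: "T = (\<lambda>z. a + c * z)"
  proof
    fix z
    have "(c \<bullet> j) * (z \<bullet> j) = (c * z) \<bullet> j" if "j \<in> Basis" for j
      using that by (auto simp: Basis_vec_def inner_axis)
    then have "(\<Sum>j\<in>Basis. ((c \<bullet> j) * (z \<bullet> j)) *\<^sub>R j) = (\<Sum>j\<in>Basis. ((c * z) \<bullet> j) *\<^sub>R j)"
      by (intro sum.cong) auto
    then show "T z = a + c * z" by (simp add: T_def euclidean_representation)
  qed
  have cj: "c \<bullet> j \<noteq> 0" if "j \<in> Basis" for j
    using that c by (auto simp: Basis_vec_def inner_axis)
  have eq: "lborel = density (distr lborel borel T) (\<lambda>_. ennreal (\<Prod>j\<in>Basis. \<bar>c \<bullet> j\<bar>))"
    unfolding T_def by (rule lborel_affine_euclidean) (rule cj)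
  have [measurable]: "T \<in> borel_measurable borel" unfolding T by measurable
  have "AE y in density (distr lborel borel T) (\<lambda>_. ennreal (\<Prod>j\<in>Basis. \<bar>c \<bullet> j\<bar>)). P y"
    using P by (subst (asm) eq)
  then have "AE y in distr lborel borel T. P y"
    using cj by (simp add: AE_density prod_pos)
  then have "AE z in lborel. P (T z)" by (rule AE_distrD[rotated]) simp
  then show ?thesis by (simp add: T)
qed

lemma AE_of_distributed:
  fixes X :: "'w \<Rightarrow> 'x::euclidean_space" and p :: "'x \<Rightarrow> real"
  assumes "distributed M lborel X (\<lambda>z. ennreal (p z))" and "AE z in lborel. P z"
  shows "AE \<omega> in M. P (X \<omega>)"
proof -
  have "(\<lambda>z. ennreal (p z)) \<in> borel_measurable lborel" using assms(1) by (rule distributed_borel_measurable)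
  then have "AE z in density lborel (\<lambda>z. ennreal (p z)). P z"
    using assms(2) by (subst AE_density) auto
  then have "AE z in distr M lborel X. P z"
    by (simp only: distributed_distr_eq_density[OF assms(1)])
  then show ?thesis by (rule AE_distrD[OF distributed_measurable[OF assms(1)]])
qed

lemma (in exp_functional) phi_eq_Phi:
  assumes p_nonneg: "\<And>z. 0 \<le> p z"
    and p: "distributed M lborel (A_infty \<alpha> B) (\<lambda>z. ennreal (p z))"
    and v [measurable]: "(\<lambda>y. indicator orthant y * v y) \<in> borel_measurable borel"
    and a: "a \<in> orthant"
  shows "phi \<alpha> p v a x = Phi (\<lambda>y. indicator orthant y * v y) a x"
proof -
  define v0 where "v0 = (\<lambda>y. indicator orthant y * v y)"
  have [measurable]: "v0 \<in> borel_measurable borel" unfolding v0_def by (rule v)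
  have "phi \<alpha> p v a x = (\<integral>z. p z * (indicator orthant z * v0 (a + exp_weights \<alpha> x * z)) \<partial>lborel)"
    unfolding phi_def set_lebesgue_integral_def
  proof (rule Bochner_Integration.integral_cong[OF refl])
    fix z
    have "(\<chi> i. a $ i + exp (-2 * (\<alpha> i \<bullet> x)) * z $ i) = a + exp_weights \<alpha> x * z" by (simp add: vec_eq_iff)
    moreover have "a + exp_weights \<alpha> x * z \<in> orthant" if "z \<in> orthant"
      by (rule orthant_add[OF a]) (use that in \<open>auto simp: orthant_def less_imp_le\<close>)
    ultimately show "indicator orthant z *\<^sub>R (p z * v (\<chi> i. a $ i + exp (-2 * (\<alpha> i \<bullet> x)) * z $ i)) =
        p z * (indicator orthant z * v0 (a + exp_weights \<alpha> x * z))"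
      by (auto simp: indicator_def v0_def)
  qed
  also have "\<dots> = (\<integral>\<omega>. indicator orthant (A_infty \<alpha> B \<omega>) * v0 (a + exp_weights \<alpha> x * A_infty \<alpha> B \<omega>) \<partial>M)"
    by (rule distributed_integral[OF p]) (auto simp: p_nonneg)
  also have "\<dots> = Phi v0 a x"
    unfolding Phi_def
  proof (rule integral_cong_AE)
    show "AE \<omega> in M. indicator orthant (A_infty \<alpha> B \<omega>) * v0 (a + exp_weights \<alpha> x * A_infty \<alpha> B \<omega>) = v0 (a + exp_weights \<alpha> x * A_infty \<alpha> B \<omega>)"
      using A_orthant by eventually_elim simp
  qed measurable
  finally show ?thesis by (simp add: v0_def)
qed

text \<open>Coordinate hyperplanes are Lebesgue-null, so the existence of a density excludes vanishing components. As a divergent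
  integral has the value \<open>0\<close>, this contains the almost sure finiteness of the functional.\<close>

lemma AE_A_infty_orthant:
  fixes \<alpha> :: "'d::finite \<Rightarrow> real ^ 'n"
  assumes "distributed M lborel (A_infty \<alpha> B) (\<lambda>z. ennreal (p z))"
  shows "AE \<omega> in M. A_infty \<alpha> B \<omega> \<in> orthant"
proof -
  have "AE z in (lborel :: (real ^ 'd) measure). z $ i \<noteq> 0" for i :: 'd
  proof -
    have "negligible {z :: real ^ 'd. axis i 1 \<bullet> z = 0}" by (rule negligible_hyperplane) (simp add: axis_eq_0_iff)
    then have "AE z in lebesgue. z \<notin> {z :: real ^ 'd. axis i 1 \<bullet> z = 0}"
      unfolding negligible_iff_null_sets by (rule AE_not_in)
    then show ?thesis by (simp add: AE_completion_iff inner_axis')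
  qed
  then have "AE z in (lborel :: (real ^ 'd) measure). \<forall>i :: 'd. z $ i \<noteq> 0" by (simp add: AE_all_countable)
  from AE_of_distributed[OF assms this]
  show ?thesis
  proof eventually_elim
    case (elim \<omega>)
    with A_infty_nonneg[of \<alpha> B \<omega>] show ?case by (auto simp: orthant_def less_le)
  qed
qed

theorem mainTheorem4:
  fixes \<alpha> :: "'d::finite \<Rightarrow> real ^ 'n"
    and \<mu> :: "real ^ 'n"
    and M :: "'w measure"
    and B :: "real \<Rightarrow> 'w \<Rightarrow> real ^ 'n"
    and p v :: "real ^ 'd \<Rightarrow> real"
  assumes "inj \<alpha>" and "\<forall>i. \<alpha> i \<noteq> 0"
    and "\<mu> \<in> Omega \<alpha>"
    and "brownian_motion_with_drift M \<mu> B"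
    and "\<forall>z. 0 \<le> p z"
    and "distributed M lborel (A_infty \<alpha> B) (\<lambda>z. ennreal (p z))"
    and "set_borel_measurable borel orthant v"
    and "\<forall>y\<in>orthant. 0 < v y"
    and "\<exists>C. \<forall>y\<in>orthant. v y \<le> C"
    and "(LINT y:orthant|lborel. v y * p y) = 1"
  shows "(\<exists>F. is_F \<alpha> p v F \<and> (\<forall>a\<in>orthant. \<forall>a'\<in>orthant. \<forall>x. F a x = F a' x)) \<longleftrightarrow>
         (\<exists>\<theta> :: real ^ 'd. AE y in lborel. y \<in> orthant \<longrightarrow>
            v y = exp (- (\<Sum>i\<in>UNIV. (\<theta> $ i)\<^sup>2 * y $ i)) / j_fun M \<alpha> B \<theta> 0)"
proof -
  note inj = assms(1) and mu = assms(3) and dens = assms(6) and vpos = assms(8)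
  obtain W where W: "standard_brownian_motion M W" "\<And>t \<omega>. 0 \<le> t \<Longrightarrow> \<omega> \<in> space M \<Longrightarrow> B t \<omega> = W t \<omega> + t *\<^sub>R \<mu>"
    using assms(4) unfolding brownian_motion_with_drift_def by blast
  interpret exp_functional M \<alpha> \<mu> W B
  proof
    show "standard_brownian_motion M W" by (rule W)
    show "B t \<omega> = W t \<omega> + t *\<^sub>R \<mu>" if "0 \<le> t" "\<omega> \<in> space M" for t \<omega> by (rule W(2)[OF that])
    show "A_infty \<alpha> B \<in> borel_measurable M" using distributed_measurable[OF dens] by simp
    show "AE \<omega> in M. A_infty \<alpha> B \<omega> \<in> orthant" by (rule AE_A_infty_orthant[OF dens])
  qed
  define v0 where "v0 y = indicator orthant y * v y" for y
  have v0m [measurable]: "v0 \<in> borel_measurable borel"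
    using assms(7) by (simp add: set_borel_measurable_def v0_def[abs_def])
  obtain C where C: "\<And>y. y \<in> orthant \<Longrightarrow> v y \<le> C" using assms(9) by blast
  have bw: "bounded_weight v0 (max C 0)"
    by unfold_locales (auto simp: v0_def indicator_def vpos[rule_format, THEN less_imp_le] le_max_iff_disj C)
  have v0_pos: "0 < v0 y" if "y \<in> orthant" for y using that vpos by (simp add: v0_def)
  have v0_out: "v0 y = 0" if "y \<notin> orthant" for y using that by (simp add: v0_def)
  have phi: "phi \<alpha> p v a x = Phi v0 a x" if "a \<in> orthant" for a x
    using phi_eq_Phi[OF _ dens _ that, of v x] assms(5) v0m by (simp add: v0_def[abs_def])
  have Phi_gt: "0 < Phi v0 a x" if "a \<in> orthant" for a x by (rule Phi_pos[OF bw v0_pos that])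
  have one: "(1 :: real ^ 'd) \<in> orthant" by (simp add: orthant_def)
  have normal: "(\<integral>\<omega>. v0 (A_infty \<alpha> B \<omega>) \<partial>M) = 1"
  proof -
    have "(\<integral>\<omega>. v0 (A_infty \<alpha> B \<omega>) \<partial>M) = (\<integral>y. p y * v0 y \<partial>lborel)"
      by (rule distributed_integral[OF dens, symmetric]) (use assms(5) in auto)
    also have "\<dots> = (LINT y:orthant|lborel. v y * p y)"
      unfolding set_lebesgue_integral_def by (simp add: v0_def mult_ac)
    finally show ?thesis using assms(10) by simp
  qed
  have j_laplace_A: "j_fun M \<alpha> B \<theta> 0 = laplace_A (\<chi> i. (\<theta> $ i)\<^sup>2) 0" for \<theta> :: "real ^ 'd"
    unfolding j_fun_def laplace_A_def by (simp add: inner_vec_def)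
  show ?thesis
  proof
    assume "\<exists>F. is_F \<alpha> p v F \<and> (\<forall>a\<in>orthant. \<forall>a'\<in>orthant. \<forall>x. F a x = F a' x)"
    then obtain F where F: "\<And>a x. a \<in> orthant \<Longrightarrow> GDERIV (\<lambda>x'. ln (phi \<alpha> p v a x')) x :> F a x"
      and Fc: "\<And>a a' x. a \<in> orthant \<Longrightarrow> a' \<in> orthant \<Longrightarrow> F a x = F a' x"
      unfolding is_F_def by blast
    have D: "((\<lambda>x. ln (Phi v0 a x)) has_derivative (\<lambda>h. h \<bullet> F 1 x)) (at x)" if "a \<in> orthant" for a x
      using F[OF that, of x] Fc[OF that one, of x] by (simp add: phi[OF that] gderiv_def)
    define h where "h x = Phi v0 1 x / Phi v0 1 0" for x
    have fact: "Phi v0 a x = Phi v0 a 0 * h x" if a: "a \<in> orthant" for a x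
    proof -
      have "\<exists>c. \<forall>x\<in>UNIV. ln (Phi v0 a x) - ln (Phi v0 1 x) = c"
        by (rule has_derivative_zero_constant) (use has_derivative_diff[OF D[OF a] D[OF one]] in auto)
      then have "ln (Phi v0 a x) - ln (Phi v0 1 x) = ln (Phi v0 a 0) - ln (Phi v0 1 0)" by (metis UNIV_I)
      then have "ln (Phi v0 a x) = ln (Phi v0 a 0 * h x)"
        using Phi_gt[OF a, of 0] Phi_gt[OF one, of x] Phi_gt[OF one, of 0] unfolding h_def
        by (subst ln_mult_pos) (simp_all add: ln_div)
      then show ?thesis using Phi_gt[OF a] Phi_gt[OF one] by (simp add: h_def)
    qed
    have hcont: "continuous_on UNIV h"
    proof -
      have "continuous_on UNIV (\<lambda>x. ln (Phi v0 1 x))"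
        using D[OF one] has_derivative_continuous continuous_at_imp_continuous_on by blast
      then have "continuous_on UNIV (\<lambda>x. exp (ln (Phi v0 1 x)))" by (rule continuous_on_exp)
      then have "continuous_on UNIV (\<lambda>x. Phi v0 1 x)" using Phi_gt[OF one] by simp
      then show ?thesis unfolding h_def using Phi_gt[OF one, of 0] by (intro continuous_intros) auto
    qed
    obtain l :: "real ^ 'd" and k where l: "\<And>i. 0 \<le> l $ i"
      and vl: "AE y in lborel. v0 y = k * (indicator orthant y * exp (- (l \<bullet> y)))"
      using exponential_of_factorization[OF mu inj bw v0_pos v0_out hcont _ fact] Phi_gt[OF one]
      by (auto simp: h_def)
    have "1 = (\<integral>\<omega>. k * exp (- (l \<bullet> (exp_weights \<alpha> 0 * A_infty \<alpha> B \<omega>))) \<partial>M)"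
      unfolding normal[symmetric]
    proof (rule integral_cong_AE)
      show "AE \<omega> in M. v0 (A_infty \<alpha> B \<omega>) = k * exp (- (l \<bullet> (exp_weights \<alpha> 0 * A_infty \<alpha> B \<omega>)))"
        using AE_of_distributed[OF dens vl] A_orthant by eventually_elim simp
    qed measurable
    then have k: "k * laplace_A l 0 = 1" by (simp add: laplace_A_def)
    define \<theta> where "\<theta> = (\<chi> i. sqrt (l $ i))"
    have th: "(\<chi> i. (\<theta> $ i)\<^sup>2) = l" by (simp add: \<theta>_def vec_eq_iff l)
    have "AE y in lborel. y \<in> orthant \<longrightarrow> v y = exp (- (\<Sum>i\<in>UNIV. (\<theta> $ i)\<^sup>2 * y $ i)) / j_fun M \<alpha> B \<theta> 0"
      using vl
    proof eventually_elim
      case (elim y)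
      have "(\<Sum>i\<in>UNIV. (\<theta> $ i)\<^sup>2 * y $ i) = l \<bullet> y" by (simp add: inner_vec_def \<theta>_def l)
      moreover have "k = 1 / laplace_A l 0" using k laplace_A_pos[OF l, of 0] by (simp add: field_simps)
      ultimately show ?case using elim by (auto simp: v0_def j_laplace_A th)
    qed
    then show "\<exists>\<theta> :: real ^ 'd. AE y in lborel. y \<in> orthant \<longrightarrow>
            v y = exp (- (\<Sum>i\<in>UNIV. (\<theta> $ i)\<^sup>2 * y $ i)) / j_fun M \<alpha> B \<theta> 0" by blast
  next
    assume "\<exists>\<theta> :: real ^ 'd. AE y in lborel. y \<in> orthant \<longrightarrow>
            v y = exp (- (\<Sum>i\<in>UNIV. (\<theta> $ i)\<^sup>2 * y $ i)) / j_fun M \<alpha> B \<theta> 0"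
    then obtain \<theta> :: "real ^ 'd" where th: "AE y in lborel. y \<in> orthant \<longrightarrow>
            v y = exp (- (\<Sum>i\<in>UNIV. (\<theta> $ i)\<^sup>2 * y $ i)) / j_fun M \<alpha> B \<theta> 0" by blast
    define l where "l = (\<chi> i. (\<theta> $ i)\<^sup>2)"
    have l: "0 \<le> l $ i" for i by (simp add: l_def)
    have Jpos: "0 < laplace_A l x" for x by (rule laplace_A_pos[OF l])
    have vl: "AE y in lborel. y \<in> orthant \<longrightarrow> v0 y = exp (- (l \<bullet> y)) / laplace_A l 0"
      using th by eventually_elim (auto simp: v0_def j_laplace_A l_def inner_vec_def)
    have PhiJ: "Phi v0 a x = exp (- (l \<bullet> a)) / laplace_A l 0 * laplace_A l x" if a: "a \<in> orthant" for a x
    proof -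
      have "AE z in lborel. a + exp_weights \<alpha> x * z \<in> orthant \<longrightarrow> v0 (a + exp_weights \<alpha> x * z) = exp (- (l \<bullet> (a + exp_weights \<alpha> x * z))) / laplace_A l 0"
        by (rule AE_lborel_affine[OF vl]) simp
      from AE_of_distributed[OF dens this] AE_shift_orthant[OF a, of x]
      have *: "AE \<omega> in M. v0 (a + exp_weights \<alpha> x * A_infty \<alpha> B \<omega>) = exp (- (l \<bullet> a)) / laplace_A l 0 * exp (- (l \<bullet> (exp_weights \<alpha> x * A_infty \<alpha> B \<omega>)))"
        by eventually_elim (simp add: inner_add_right exp_add[symmetric])
      have "Phi v0 a x = (\<integral>\<omega>. exp (- (l \<bullet> a)) / laplace_A l 0 * exp (- (l \<bullet> (exp_weights \<alpha> x * A_infty \<alpha> B \<omega>))) \<partial>M)"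
        unfolding Phi_def by (rule integral_cong_AE[OF _ _ *]) measurable
      then show ?thesis by (simp add: laplace_A_def)
    qed
    define F where "F a x = (SOME D. GDERIV (\<lambda>x. ln (laplace_A l x)) x :> D)" for a :: "real ^ 'd" and x
    have "is_F \<alpha> p v F"
      unfolding is_F_def
    proof (intro ballI allI)
      fix a :: "real ^ 'd" and x assume a: "a \<in> orthant"
      obtain D where "GDERIV (laplace_A l) x :> D" using laplace_A_GDERIV[OF l] by blast
      from GDERIV_DERIV_compose[OF this DERIV_ln[OF Jpos]]
      have "GDERIV (\<lambda>x. ln (laplace_A l x)) x :> F a x" unfolding F_def by (rule someI)
      from GDERIV_add[OF GDERIV_const[of "ln (exp (- (l \<bullet> a)) / laplace_A l 0)"] this]
      have "GDERIV (\<lambda>x'. ln (exp (- (l \<bullet> a)) / laplace_A l 0) + ln (laplace_A l x')) x :> F a x" by simp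
      moreover have "ln (phi \<alpha> p v a x') = ln (exp (- (l \<bullet> a)) / laplace_A l 0) + ln (laplace_A l x')" for x'
        unfolding phi[OF a] PhiJ[OF a] by (rule ln_mult_pos) (simp_all add: Jpos)
      ultimately show "GDERIV (\<lambda>x'. ln (phi \<alpha> p v a x')) x :> F a x" by simp
    qed
    then show "\<exists>F. is_F \<alpha> p v F \<and> (\<forall>a\<in>orthant. \<forall>a'\<in>orthant. \<forall>x. F a x = F a' x)"
      by (intro exI[of _ F]) (simp add: F_def)
  qed
qed

end
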